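(* Let $b_{n0},b_{n1},b_{n2}>0$ be such that for every $\beta\in B(\beta^*,\epsilon_n)$, with $\pi_{ij}=\beta_i-\beta_j$ (and $\beta_0=0$), $$[\min_{i,j}\mu'(\pi_{ij})]\cdot[\max_{i,j}\mu'(\pi_{ij})]>0,\qquad b_{n0}\le \min_{i,j}|\mu'(\pi_{ij})|\le \max_{i,j}|\mu'(\pi_{ij})|\le b_{n1},\qquad \max_{i,j}|\mu''(\pi_{ij})|\le b_{n2}.$$ If, as $n\to\infty$, $$\frac{b_{n1}^4\, b_{n2}}{b_{n0}^6\, p_n^4}=o\big((n/\log n)^{1/2}\big),$$ then the moment estimator $\widehat\beta$ exists with probability approaching one and is uniformly consistent in the sense that $$\|\widehat\beta-\beta^*\|_\infty=O_p\left(\frac{b_{n1}^2}{b_{n0}^3p_n^2}\sqrt{\frac{\log n}{n}}\right)=o_p(1).$$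
   Context: Model. There are $n+1$ subjects labeled $0,\dots,n$ with merit parameters $\beta_0,\dots,\beta_n$, normalized by $\beta_0=0$, so the parameter is $\beta=(\beta_1,\dots,\beta_n)^\top\in\mathbb{R}^n$; $\beta^*$ denotes the true parameter (with $\beta_0^*=0$). All quantities $\beta^*,p_n,\epsilon_n,b_{n0},b_{n1},b_{n2}$ may depend on $n$. For $0\le i<j\le n$ the numbers of comparisons $t_{ij}=t_{ji}$ are independent with $t_{ij}\sim \mathrm{Bin}(T,p_n)$ (Erdős–Rényi comparison graph), where $T\ge1$ is a fixed integer and $p_n\in(0,1]$ may tend to $0$; $t_{ii}=0$. Conditionally on all the $t_{ij}$, the variables $a_{ij}$, $i<j$, are independent with $a_{ij}\sim \mathrm{Bin}(t_{ij},p_{ij})$, $p_{ij}=F(\beta_i^*-\beta_j^* )$, where $F$ is a known cumulative distribution function with $F(x)=1-F(-x)$; $a_{ij}$ is the number of wins of $i$ over $j$, $a_{ji}=t_{ij}-a_{ij}$, $a_{ii}=0$. Let $a_i=\sum_{j=0}^n a_{ij}$. Mean function. $\mu(x)=F(x)$, so that the conditional mean of $a_{ij}$ given $t_{ij}$ is $t_{ij}\mu(\beta^*_i-\beta^*_j)$; $\mu$ is assumed to be continuous and to have a third derivative; $\mu',\mu''$ are its first and second derivatives. Moment estimator. $\widehat\beta=(\widehat\beta_1,\dots,\widehat\beta_n)^\top$ (with $\widehat\beta_0=0$) is a solution of the equations $a_i=\sum_{j\ne i}t_{ij}\mu(\beta_i-\beta_j)$, $i=1,\dots,n$. Notation. $\|x\|_\infty=\max_i|x_i|$;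 $B(x,\epsilon)=\{y\in\mathbb{R}^n:\|x-y\|_\infty\le\epsilon\}$; $\epsilon_n$ is a small positive number; $\min_{i,j},\max_{i,j}$ run over $i,j\in\{0,\dots,n\}$. $O_p,o_p$ are as $n\to\infty$.
   Formalization: The formal theorem adds that the rate b_{n1}^2/(b_{n0}^3 p_n^2) sqrt(log n/n) is o(ε_n); without a link between ε_n and the rate the claim fails (logistic F, T=1, β*=0, p_n=n^{-2}, ε_n=n^{-100}, b_{n2} of order n^{-99}: no solution with positive limiting probability). *)

theory Defs
  imports "HOL-Probability.Probability" "HOL-Library.Landau_Symbols"
begin

text \<open>
  Subjects are \<open>0, \<dots>, n\<close>. A parameter vector of \<open>\<real>\<^sup>n\<close> is a function \<open>nat \<Rightarrow> real\<close> of which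
  only the components \<open>1, \<dots>, n\<close> matter, together with the convention that component \<open>0\<close> is \<open>0\<close>;
  components beyond \<open>n\<close> are junk. The numbers \<open>t i j\<close> and \<open>a i j\<close> are random variables, the
  argument of type \<open>'a\<close> being the sample point.
\<close>

text \<open>
  ``Conditionally on all the \<open>t i j\<close>'': for each realisation \<open>\<tau>\<close> of positive probability, the law is
  that of the conditional probability measure given that event.
\<close>

locale paired_comparison = prob_space M
  for M :: "'a measure" and n T :: nat and p :: real and F :: "real \<Rightarrow> real"
    and \<beta>s :: "nat \<Rightarrow> real" and t a :: "nat \<Rightarrow> nat \<Rightarrow> 'a \<Rightarrow> nat" +
  assumes p_pos: "0 < p" and p_le_1: "p \<le> 1"
    and \<beta>s_0: "\<beta>s 0 = 0"
    and t_sym: "\<And>i j \<omega>. \<lbrakk>i \<le> n; j \<le> n; \<omega> \<in> space M\<rbrakk> \<Longrightarrow> t i j \<omega> = t j i \<omega>"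
    and t_diag: "\<And>i \<omega>. \<lbrakk>i \<le> n; \<omega> \<in> space M\<rbrakk> \<Longrightarrow> t i i \<omega> = 0"
    and t_indep: "indep_vars (\<lambda>_. count_space UNIV) (\<lambda>(i, j). t i j) {(i, j). i < j \<and> j \<le> n}"
    and t_binomial: "\<And>i j. \<lbrakk>i < j; j \<le> n\<rbrakk> \<Longrightarrow>
      distr M (count_space UNIV) (t i j) = measure_pmf (binomial_pmf T p)"
    and a_total: "\<And>i j \<omega>. \<lbrakk>i < j; j \<le> n; \<omega> \<in> space M\<rbrakk> \<Longrightarrow> a i j \<omega> + a j i \<omega> = t i j \<omega>"
    and a_diag: "\<And>i \<omega>. \<lbrakk>i \<le> n; \<omega> \<in> space M\<rbrakk> \<Longrightarrow> a i i \<omega> = 0"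
    and a_cond_indep: "\<And>\<tau> E. \<lbrakk>E = {\<omega> \<in> space M. \<forall>i j. i < j \<and> j \<le> n \<longrightarrow> t i j \<omega> = \<tau> i j}; prob E > 0\<rbrakk> \<Longrightarrow>
      prob_space.indep_vars (uniform_measure M E)
        (\<lambda>_. count_space UNIV) (\<lambda>(i, j). a i j) {(i, j). i < j \<and> j \<le> n}"
    and a_cond_binomial: "\<And>\<tau> E i j. \<lbrakk>E = {\<omega> \<in> space M. \<forall>i j. i < j \<and> j \<le> n \<longrightarrow> t i j \<omega> = \<tau> i j}; prob E > 0;
        i < j; j \<le> n\<rbrakk> \<Longrightarrow>
      distr (uniform_measure M E) (count_space UNIV) (a i j)
        = measure_pmf (binomial_pmf (\<tau> i j) (F (\<beta>s i - \<beta>s j)))"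

definition sup_dist :: "nat \<Rightarrow> (nat \<Rightarrow> real) \<Rightarrow> (nat \<Rightarrow> real) \<Rightarrow> real" where
  "sup_dist n x y = Max ((\<lambda>i. \<bar>x i - y i\<bar>) ` {1..n})"

definition sup_ball :: "nat \<Rightarrow> (nat \<Rightarrow> real) \<Rightarrow> real \<Rightarrow> (nat \<Rightarrow> real) set" where
  "sup_ball n x \<epsilon> = {\<beta>. \<beta> 0 = 0 \<and> sup_dist n x \<beta> \<le> \<epsilon>}"

definition pair_values :: "nat \<Rightarrow> (real \<Rightarrow> real) \<Rightarrow> (nat \<Rightarrow> real) \<Rightarrow> real set" where
  "pair_values n f \<beta> = (\<lambda>(i, j). f (\<beta> i - \<beta> j)) ` ({0..n} \<times> {0..n})"

definition derivative_bounds ::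
    "nat \<Rightarrow> (real \<Rightarrow> real) \<Rightarrow> (nat \<Rightarrow> real) \<Rightarrow> real \<Rightarrow> real \<Rightarrow> real \<Rightarrow> real \<Rightarrow> bool" where
  "derivative_bounds n \<mu> \<beta>s \<epsilon> b0 b1 b2 \<longleftrightarrow>
     0 < b0 \<and> 0 < b1 \<and> 0 < b2 \<and>
     (\<forall>\<beta> \<in> sup_ball n \<beta>s \<epsilon>.
        Min (pair_values n (deriv \<mu>) \<beta>) * Max (pair_values n (deriv \<mu>) \<beta>) > 0 \<and>
        b0 \<le> Min (pair_values n (\<lambda>x. \<bar>deriv \<mu> x\<bar>) \<beta>) \<and>
        Max (pair_values n (\<lambda>x. \<bar>deriv \<mu> x\<bar>) \<beta>) \<le> b1 \<and>
        Max (pair_values n (\<lambda>x. \<bar>deriv (deriv \<mu>) x\<bar>) \<beta>) \<le> b2)"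

definition moment_solution ::
    "nat \<Rightarrow> (real \<Rightarrow> real) \<Rightarrow> (nat \<Rightarrow> nat \<Rightarrow> nat) \<Rightarrow> (nat \<Rightarrow> nat \<Rightarrow> nat) \<Rightarrow> (nat \<Rightarrow> real) \<Rightarrow> bool" where
  "moment_solution n \<mu> t a \<beta> \<longleftrightarrow> \<beta> 0 = 0 \<and>
     (\<forall>i\<in>{1..n}. real (\<Sum>j=0..n. a i j) = (\<Sum>j\<in>{0..n} - {i}. real (t i j) * \<mu> (\<beta> i - \<beta> j)))"

text \<open>
  A moment estimator is a random vector that solves the moment equations whenever they are solvable;
  its value is arbitrary otherwise.
\<close>

definition moment_estimator ::
    "'a measure \<Rightarrow> nat \<Rightarrow> (real \<Rightarrow> real) \<Rightarrow> (nat \<Rightarrow> nat \<Rightarrow> 'a \<Rightarrow> nat) \<Rightarrow> (nat \<Rightarrow> nat \<Rightarrow> 'a \<Rightarrow> nat)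
      \<Rightarrow> ('a \<Rightarrow> nat \<Rightarrow> real) \<Rightarrow> bool" where
  "moment_estimator M n \<mu> t a \<beta>h \<longleftrightarrow>
     (\<forall>i\<in>{1..n}. (\<lambda>\<omega>. \<beta>h \<omega> i) \<in> borel_measurable M) \<and>
     (\<forall>\<omega>\<in>space M. (\<exists>\<beta>. moment_solution n \<mu> (\<lambda>i j. t i j \<omega>) (\<lambda>i j. a i j \<omega>) \<beta>) \<longrightarrow>
        moment_solution n \<mu> (\<lambda>i j. t i j \<omega>) (\<lambda>i j. a i j \<omega>) (\<beta>h \<omega>))"

definition big_O_p :: "(nat \<Rightarrow> 'a measure) \<Rightarrow> (nat \<Rightarrow> 'a \<Rightarrow> real) \<Rightarrow> (nat \<Rightarrow> real) \<Rightarrow> bool" where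
  "big_O_p M X r \<longleftrightarrow> (\<forall>\<eta>>0. \<exists>C>0. \<forall>\<^sub>F n in sequentially.
     measure (M n) {\<omega> \<in> space (M n). \<bar>X n \<omega>\<bar> > C * \<bar>r n\<bar>} < \<eta>)"

definition small_o_p :: "(nat \<Rightarrow> 'a measure) \<Rightarrow> (nat \<Rightarrow> 'a \<Rightarrow> real) \<Rightarrow> (nat \<Rightarrow> real) \<Rightarrow> bool" where
  "small_o_p M X r \<longleftrightarrow> (\<forall>\<delta>>0.
     (\<lambda>n. measure (M n) {\<omega> \<in> space (M n). \<bar>X n \<omega>\<bar> > \<delta> * \<bar>r n\<bar>}) \<longlonglongrightarrow> 0)"

definition consistency_rate :: "nat \<Rightarrow> real \<Rightarrow> real \<Rightarrow> real \<Rightarrow> real" where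
  "consistency_rate n p b0 b1 = b1\<^sup>2 / (b0 ^ 3 * p\<^sup>2) * sqrt (ln (real n) / real n)"

end

theory Submission
  imports Defs "HOL-Real_Asymp.Real_Asymp"
begin

text \<open>
  Let \<open>u\<close> be the deviation of a solution of the moment equations from the true parameter. By the mean
  value theorem \<open>u\<close> solves a weighted graph Laplacian equation whose right-hand side is the noise
  \<open>a\<^sub>i - E[a\<^sub>i | t]\<close>, of order \<open>sqrt (n log n)\<close> uniformly in \<open>i\<close> by Hoeffding's inequality given \<open>t\<close>.
  At a maximiser of \<open>u\<close> all terms of the Laplacian have one sign, so \<open>u\<close> is close to its maximum on
  average over the neighbours, and likewise for a minimiser. Any two vertices have at least of order
  \<open>n p\<^sup>2\<close> common neighbours, so the oscillation of \<open>u\<close> is of order \<open>sqrt (log n / n) / (b0 p\<^sup>2)\<close>, and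
  \<open>b0 \<le> b1\<close> makes this at most the claimed rate. The same comparison shows that a solution in the box is
  the only solution at all. A solution constrained to a box exists by Perron's method, and the
  oscillation bound keeps it off the boundary.
\<close>

subsection \<open>Existence and uniqueness for given counts\<close>

text \<open>An estimator may be any solution of the equations, wherever it lies, while the
  derivative bounds hold only in the ball around the true parameter; elsewhere \<open>F\<close> may
  even be flat. An error bound for one solution is therefore not enough, and uniqueness among all
  solutions has to rely on mere monotonicity of \<open>F\<close> away from the box. Vertex 0 has no
  equation, yet it may be the maximiser or the minimiser of the deviation; its equation is recovered
  from the conservation of the total number of wins. Finally, nothing is assumed about the density
  of the comparison graph: that \<open>n p^4\<close> exceeds a multiple of \<open>log n\<close>,
  which common neighbours require, is extracted from the smallness of the rate itself. This works
  because the slope of \<open>F\<close> at 0, a constant independent of \<open>n\<close>, always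
  lies between \<open>b0\<close> and \<open>b1\<close>.\<close>

lemma sum_nat_split_first:
  fixes f :: "nat \<Rightarrow> real"
  shows "sum f {0..n} = f 0 + sum f {1..n}"
  by (simp add: sum.atLeast_Suc_atMost)

text \<open>One realisation of the counts is frozen here, so existence, uniqueness and the error
  bound become deterministic; chance enters later only through the noise level \<open>E\<close> and
  the number of common neighbours.\<close>

locale comparison_equations =
  fixes n :: nat and F :: "real \<Rightarrow> real" and t a :: "nat \<Rightarrow> nat \<Rightarrow> nat"
  assumes F_mono: "mono F"
    and F_cont: "continuous_on UNIV F"
    and F_sym: "\<And>x. F x = 1 - F (- x)"
    and t_sym: "\<And>i j. \<lbrakk>i \<le> n; j \<le> n\<rbrakk> \<Longrightarrow> t i j = t j i"
    and t_diag: "\<And>i. i \<le> n \<Longrightarrow> t i i = 0"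
    and a_total: "\<And>i j. \<lbrakk>i \<le> n; j \<le> n\<rbrakk> \<Longrightarrow> a i j + a j i = t i j"
begin

text \<open>Allowing \<open>i = 0\<close> and keeping the vanishing diagonal term lets all
  \<open>n + 1\<close> vertices be treated alike.\<close>

definition score :: "(nat \<Rightarrow> real) \<Rightarrow> nat \<Rightarrow> real" where
  "score y i = (\<Sum>j=0..n. real (t i j) * F (y i - y j))"

definition wins :: "nat \<Rightarrow> real" where
  "wins i = real (\<Sum>j=0..n. a i j)"

definition common_neighbours :: "nat \<Rightarrow> nat \<Rightarrow> nat set" where
  "common_neighbours i k = {j. j \<le> n \<and> 0 < t i j \<and> 0 < t k j}"

lemma moment_solution_iff:
  "moment_solution n F t a y \<longleftrightarrow> y 0 = 0 \<and> (\<forall>i\<in>{1..n}. score y i = wins i)"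
proof -
  have "(\<Sum>j\<in>{0..n} - {i}. real (t i j) * F (y i - y j)) = score y i" if "i \<in> {1..n}" for i
    using that t_diag[of i] by (simp add: score_def sum.remove[of "{0..n}" i])
  then show ?thesis
    by (auto simp: moment_solution_def wins_def)
qed

text \<open>However the matches of a pair are split, the two entries add up to \<open>t i j\<close>.
  This applies to actual wins and, since \<open>F(x) + F(-x) = 1\<close>, to expected wins at any
  parameter.\<close>

lemma sum_antisymmetric_halves:
  fixes f :: "nat \<Rightarrow> nat \<Rightarrow> real"
  assumes "\<And>i j. \<lbrakk>i \<le> n; j \<le> n\<rbrakk> \<Longrightarrow> f i j + f j i = real (t i j)"
  shows "(\<Sum>i=0..n. \<Sum>j=0..n. f i j) = (\<Sum>i=0..n. \<Sum>j=0..n. real (t i j)) / 2"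
proof -
  have "(\<Sum>i=0..n. \<Sum>j=0..n. f i j) = (\<Sum>i=0..n. \<Sum>j=0..n. f j i)"
    by (rule sum.swap)
  moreover have "(\<Sum>i=0..n. \<Sum>j=0..n. f i j) + (\<Sum>i=0..n. \<Sum>j=0..n. f j i) = (\<Sum>i=0..n. \<Sum>j=0..n. real (t i j))"
    unfolding sum.distrib[symmetric] using assms by (intro sum.cong refl) auto
  ultimately show ?thesis by simp
qed

lemma sum_score_eq_sum_wins: "(\<Sum>i=0..n. score y i) = (\<Sum>i=0..n. wins i)"
proof -
  have "(\<Sum>i=0..n. score y i) = (\<Sum>i=0..n. \<Sum>j=0..n. real (t i j)) / 2"
    unfolding score_def
  proof (rule sum_antisymmetric_halves)
    fix i j assume "i \<le> n" "j \<le> n"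
    then show "real (t i j) * F (y i - y j) + real (t j i) * F (y j - y i) = real (t i j)"
      using t_sym[of i j] F_sym[of "y i - y j"] by (simp add: distrib_left[symmetric])
  qed
  moreover have "(\<Sum>i=0..n. wins i) = (\<Sum>i=0..n. \<Sum>j=0..n. real (t i j)) / 2"
    unfolding wins_def of_nat_sum
    by (rule sum_antisymmetric_halves) (metis a_total of_nat_add)
  ultimately show ?thesis by simp
qed

text \<open>The substitute for the missing equation at vertex 0: the total is conserved, so the
  defect there is opposite to the sum of the other defects, and one-sided information at
  \<open>1..n\<close> passes to vertex 0.\<close>

lemma score_0_eq: "score y 0 = wins 0 + (\<Sum>i=1..n. wins i - score y i)"
  using sum_score_eq_sum_wins[of y]
  unfolding sum_nat_split_first[of "score y"] sum_nat_split_first[of wins]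
  by (simp add: sum_subtractf)

lemma score_solution:
  assumes "moment_solution n F t a y" "i \<le> n"
  shows "score y i = wins i"
proof (cases "i = 0")
  case True
  have "(\<Sum>i=1..n. wins i - score y i) = 0"
    using assms(1) by (intro sum.neutral) (simp add: moment_solution_iff)
  then show ?thesis using True score_0_eq[of y] by simp
qed (use assms in \<open>simp add: moment_solution_iff\<close>)

text \<open>
  Perron's method: the score of \<open>i\<close> increases in \<open>y i\<close> and decreases in the other coordinates, so
  the pointwise supremum of subsolutions is again a subsolution, and its maximality makes it a solution
  wherever it does not touch the box.
\<close>

lemma clamped_solution:
  assumes R: "0 \<le> R"
  obtains y where "y 0 = 0" "\<And>i. i \<in> {1..n} \<Longrightarrow> \<bar>y i - x i\<bar> \<le> R"
    "\<And>i. \<lbrakk>i \<in> {1..n}; x i - R < y i\<rbrakk> \<Longrightarrow> score y i \<le> wins i"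
    "\<And>i. \<lbrakk>i \<in> {1..n}; y i < x i + R\<rbrakk> \<Longrightarrow> wins i \<le> score y i"
proof -
  \<comment> \<open>The alternative \<open>y i = x i - R\<close> exempts the bottom of the box, so
    the lowest point of the box is a subsolution and \<open>Q\<close> is nonempty.\<close>
  define Q where "Q = {y. y 0 = 0 \<and> (\<forall>i\<in>{1..n}. x i - R \<le> y i \<and> y i \<le> x i + R \<and>
    (y i = x i - R \<or> score y i \<le> wins i))}"
  define s where "s i = (if i \<in> {1..n} then SUP y\<in>Q. y i else 0)" for i
  have cont: "continuous_on A (\<lambda>h. F (f h))" if "continuous_on A f" for A :: "real set" and f
    using continuous_on_compose2[OF F_cont that] by auto
  have "(\<lambda>i. if i = 0 then 0 else x i - R) \<in> Q"
    using R by (auto simp: Q_def)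
  then have Q_ne: "Q \<noteq> {}" by auto
  have bdd: "bdd_above ((\<lambda>y. y i) ` Q)" if "i \<in> {1..n}" for i
    using that by (intro bdd_aboveI[of _ "x i + R"]) (auto simp: Q_def)
  have s_0: "s 0 = 0" by (simp add: s_def)
  have s_ge: "y i \<le> s i" if "y \<in> Q" "i \<le> n" for y i
    using that cSUP_upper[OF that(1) bdd[of i]] by (cases "i = 0") (auto simp: s_def Q_def)
  have s_le: "s i \<le> x i + R" if "i \<in> {1..n}" for i
    using that Q_ne by (auto simp: s_def Q_def intro!: cSUP_least)
  have s_lower: "x i - R \<le> s i" if "i \<in> {1..n}" for i
  proof -
    obtain y where "y \<in> Q" using Q_ne by auto
    then show ?thesis using s_ge[of y i] that unfolding Q_def by force
  qed
  \<comment> \<open>The supremum need not be attained at \<open>i\<close>. Lower it by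
    \<open>h\<close> and take \<open>y\<close> in \<open>Q\<close> with
    \<open>y i > s i - h\<close>: since \<open>y j \<le> s j\<close>, the score of \<open>y\<close>
    at \<open>i\<close> dominates \<open>f h\<close>. The limit on \<open>h\<close> keeps
    \<open>y i\<close> off the bottom of the box, and continuity lets \<open>h\<close> tend to
    0.\<close>
  have s_sub: "score s i \<le> wins i" if i: "i \<in> {1..n}" "x i - R < s i" for i
  proof -
    define f where "f h = (\<Sum>j\<in>{0..n}-{i}. real (t i j) * F (s i - h - s j))" for h
    have "continuous_on UNIV f"
      unfolding f_def by (intro continuous_intros cont)
    then have "isCont f 0"
      by (simp add: continuous_on_eq_continuous_at)
    then have "(f \<longlongrightarrow> f 0) (at_right 0)"
      by (simp add: isCont_def filterlim_at_split)
    moreover have "eventually (\<lambda>h. f h \<le> wins i) (at_right 0)"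
      unfolding eventually_at_right_field
    proof (intro exI[of _ "s i - (x i - R)"] conjI allI impI)
      show "0 < s i - (x i - R)" using i by simp
      fix h :: real assume h: "0 < h" "h < s i - (x i - R)"
      have "s i - h < (SUP y\<in>Q. y i)" using h i by (simp add: s_def)
      then obtain y where y: "y \<in> Q" "s i - h < y i"
        using less_cSUP_iff[OF Q_ne bdd[OF i(1)]] by auto
      have "f h \<le> (\<Sum>j\<in>{0..n}-{i}. real (t i j) * F (y i - y j))"
        unfolding f_def
      proof (intro sum_mono mult_left_mono monoD[OF F_mono])
        fix j assume "j \<in> {0..n} - {i}"
        then show "s i - h - s j \<le> y i - y j" using s_ge[OF y(1), of j] y(2) by simp
      qed simp
      also have "\<dots> = score y i"
        using i t_diag[of i] by (simp add: score_def sum.remove[of "{0..n}" i])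
      also have "\<dots> \<le> wins i"
        using y h i by (force simp: Q_def)
      finally show "f h \<le> wins i" .
    qed
    ultimately have "f 0 \<le> wins i"
      by (rule tendsto_upperbound) simp
    then show ?thesis
      using i t_diag[of i] by (simp add: score_def f_def sum.remove[of "{0..n}" i])
  qed
  have s_Q: "s \<in> Q"
    unfolding Q_def using s_0 s_le s_lower s_sub by force
  \<comment> \<open>Otherwise coordinate \<open>i\<close> could be raised slightly: continuity keeps
    the inequality at \<open>i\<close>, the other scores only decrease, and the raised point of
    \<open>Q\<close> exceeds the supremum.\<close>
  have s_super: "wins i \<le> score s i" if i: "i \<in> {1..n}" "s i < x i + R" for i
  proof (rule ccontr)
    assume neg: "\<not> wins i \<le> score s i"
    define f where "f h = (\<Sum>j\<in>{0..n}-{i}. real (t i j) * F (s i + h - s j))" for h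
    have score_upd: "score (s(i := s i + h)) i = f h" for h
      using i t_diag[of i] by (simp add: score_def f_def sum.remove[of "{0..n}" i])
    have "continuous_on UNIV f"
      unfolding f_def by (intro continuous_intros cont)
    then have "isCont f 0"
      by (simp add: continuous_on_eq_continuous_at)
    then have "(f \<longlongrightarrow> f 0) (at_right 0)"
      by (simp add: isCont_def filterlim_at_split)
    moreover have "f 0 < wins i"
      using neg score_upd[of 0] by simp
    ultimately have "eventually (\<lambda>h. f h < wins i) (at_right 0)"
      by (rule order_tendstoD)
    moreover have "eventually (\<lambda>h. h < x i + R - s i) (at_right 0)"
      using i eventually_at_right_less[of 0] by (intro eventually_at_rightI[of 0 "x i + R - s i"]) auto
    moreover have "eventually (\<lambda>h::real. 0 < h) (at_right 0)"
      by (simp add: eventually_at_right_less)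
    ultimately have "eventually (\<lambda>h. f h < wins i \<and> h < x i + R - s i \<and> 0 < h) (at_right 0)"
      by eventually_elim simp
    then obtain h where h: "f h < wins i" "h < x i + R - s i" "0 < h"
      using eventually_happens'[OF trivial_limit_at_right_real] by fast
    have "s(i := s i + h) \<in> Q"
      unfolding Q_def
    proof (intro CollectI conjI ballI)
      show "(s(i := s i + h)) 0 = 0" using i s_0 by simp
      fix k assume k: "k \<in> {1..n}"
      show "x k - R \<le> (s(i := s i + h)) k" "(s(i := s i + h)) k \<le> x k + R"
        using s_lower[OF k] s_le[OF k] h by auto
      show "(s(i := s i + h)) k = x k - R \<or> score (s(i := s i + h)) k \<le> wins k"
      proof (cases "k = i")
        case True
        then show ?thesis using score_upd[of h] h by simp
      next
        case False
        have "score (s(i := s i + h)) k \<le> score s k"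
          unfolding score_def using False h
          by (intro sum_mono mult_left_mono monoD[OF F_mono]) auto
        moreover have "s k = x k - R \<or> score s k \<le> wins k"
          using s_Q k by (simp add: Q_def)
        ultimately show ?thesis using False by auto
      qed
    qed
    then show False using s_ge[of "s(i := s i + h)" i] i h by simp
  qed
  show thesis
  proof (rule that[of s])
    fix i assume "i \<in> {1..n}"
    then show "\<bar>s i - x i\<bar> \<le> R" using s_lower[of i] s_le[of i] by simp
  qed (use s_0 s_sub s_super in auto)
qed

text \<open>
  Both the argmax and the argmin of the deviation \<open>y - x\<close> are close to all their neighbours; a common
  neighbour links them.
\<close>

lemma oscillation_bound:
  assumes i: "i \<le> n" and k: "k \<le> n"
    and argmax: "\<And>j. j \<le> n \<Longrightarrow> y j - x j \<le> y i - x i"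
    and argmin: "\<And>j. j \<le> n \<Longrightarrow> y k - x k \<le> y j - x j"
    and incr: "\<And>i j. \<lbrakk>i \<le> n; j \<le> n; x i - x j \<le> y i - y j\<rbrakk> \<Longrightarrow>
      b * ((y i - y j) - (x i - x j)) \<le> F (y i - y j) - F (x i - x j)"
    and b: "0 \<le> b"
    and up: "score y i - score x i \<le> E" and down: "score x k - score y k \<le> E"
  shows "b * real (card (common_neighbours i k)) * ((y i - x i) - (y k - x k)) \<le> 2 * E"
proof -
  let ?N = "common_neighbours i k" and ?u = "\<lambda>j. y j - x j"
  have N: "?N \<subseteq> {0..n}" by (auto simp: common_neighbours_def)
  \<comment> \<open>Multiplicities are discarded: an edge counts at least once.\<close>
  have scale: "c \<le> real m * d" if "c \<le> d" "0 \<le> c" "0 < m" for c d :: real and m :: nat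
  proof -
    have "1 * d \<le> real m * d" using that by (intro mult_right_mono) auto
    then show ?thesis using that by simp
  qed
  have "(\<Sum>j\<in>?N. b * (?u i - ?u j)) \<le> (\<Sum>j\<in>?N. real (t i j) * (F (y i - y j) - F (x i - x j)))"
  proof (intro sum_mono scale)
    fix j assume j: "j \<in> ?N"
    then have "j \<le> n" by (simp add: common_neighbours_def)
    show "b * (?u i - ?u j) \<le> F (y i - y j) - F (x i - x j)"
      using incr[of i j] argmax[of j] i \<open>j \<le> n\<close> by (simp add: algebra_simps)
    show "0 \<le> b * (?u i - ?u j)" using b argmax[of j] \<open>j \<le> n\<close> by simp
    show "0 < t i j" using j by (simp add: common_neighbours_def)
  qed
  also have "\<dots> \<le> (\<Sum>j=0..n. real (t i j) * (F (y i - y j) - F (x i - x j)))"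
  proof (intro sum_mono2 N)
    fix j assume "j \<in> {0..n} - ?N"
    then have "x i - x j \<le> y i - y j" using argmax[of j] by simp
    then show "0 \<le> real (t i j) * (F (y i - y j) - F (x i - x j))"
      using monoD[OF F_mono] by simp
  qed simp
  also have "\<dots> \<le> E"
    using up by (simp add: score_def sum_subtractf right_diff_distrib)
  finally have 1: "(\<Sum>j\<in>?N. b * (?u i - ?u j)) \<le> E" .
  have "(\<Sum>j\<in>?N. b * (?u j - ?u k)) \<le> (\<Sum>j\<in>?N. real (t k j) * (F (x k - x j) - F (y k - y j)))"
  proof (intro sum_mono scale)
    fix j assume j: "j \<in> ?N"
    then have "j \<le> n" by (simp add: common_neighbours_def)
    then have "b * (?u j - ?u k) \<le> F (y j - y k) - F (x j - x k)"
      using incr[of j k] argmin[of j] k by (simp add: algebra_simps)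
    then show "b * (?u j - ?u k) \<le> F (x k - x j) - F (y k - y j)"
      using F_sym[of "x k - x j"] F_sym[of "y k - y j"] by simp
    show "0 \<le> b * (?u j - ?u k)" using b argmin[of j] \<open>j \<le> n\<close> by simp
    show "0 < t k j" using j by (simp add: common_neighbours_def)
  qed
  also have "\<dots> \<le> (\<Sum>j=0..n. real (t k j) * (F (x k - x j) - F (y k - y j)))"
  proof (intro sum_mono2 N)
    fix j assume "j \<in> {0..n} - ?N"
    then have "y k - y j \<le> x k - x j" using argmin[of j] by simp
    then show "0 \<le> real (t k j) * (F (x k - x j) - F (y k - y j))"
      using monoD[OF F_mono] by simp
  qed simp
  also have "\<dots> \<le> E"
    using down by (simp add: score_def sum_subtractf right_diff_distrib)
  finally have 2: "(\<Sum>j\<in>?N. b * (?u j - ?u k)) \<le> E" .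
  \<comment> \<open>For each common neighbour \<open>j\<close> the value at \<open>j\<close> cancels
    between the two gaps, leaving the oscillation once per common neighbour.\<close>
  have "b * real (card ?N) * (?u i - ?u k) = (\<Sum>j\<in>?N. b * (?u i - ?u j)) + (\<Sum>j\<in>?N. b * (?u j - ?u k))"
    unfolding sum.distrib[symmetric] by (simp add: algebra_simps)
  then show ?thesis using 1 2 by linarith
qed

lemma argmax_exists:
  fixes u :: "nat \<Rightarrow> real"
  shows "\<exists>i\<le>n. \<forall>j\<le>n. u j \<le> u i"
proof -
  have "Max (u ` {0..n}) \<in> u ` {0..n}" by (intro Max_in) auto
  then obtain i where i: "i \<in> {0..n}" "Max (u ` {0..n}) = u i" by (rule imageE) auto
  have "\<forall>j\<le>n. u j \<le> u i" using Max_ge[of "u ` {0..n}"] i by auto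
  then show ?thesis using i by auto
qed

text \<open>The deviation vanishes at vertex 0, so it is nonnegative at its maximiser and
  nonpositive at its minimiser. Neither touches the side of the box that would spoil the one-sided
  inequality needed by the oscillation bound. An oscillation below \<open>R\<close> together with a
  zero at vertex 0 then keeps every coordinate strictly inside, where the clamped solution satisfies
  the equations.\<close>

lemma moment_solution_exists:
  assumes x_0: "x 0 = 0" and R: "0 < R" and b: "0 < b"
    and noise: "\<And>i. i \<le> n \<Longrightarrow> \<bar>wins i - score x i\<bar> \<le> E"
    and incr: "\<And>y i j. \<lbrakk>y 0 = 0; \<And>i. i \<le> n \<Longrightarrow> \<bar>y i - x i\<bar> \<le> R; i \<le> n; j \<le> n; x i - x j \<le> y i - y j\<rbrakk> \<Longrightarrow>
      b * ((y i - y j) - (x i - x j)) \<le> F (y i - y j) - F (x i - x j)"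
    and common: "\<And>i k. \<lbrakk>i \<le> n; k \<le> n; i \<noteq> k\<rbrakk> \<Longrightarrow> m \<le> real (card (common_neighbours i k))"
    and small: "2 * E < b * m * R"
  obtains y where "moment_solution n F t a y" "\<And>i. i \<le> n \<Longrightarrow> \<bar>y i - x i\<bar> \<le> R"
proof -
  obtain y where y: "y 0 = 0" "\<And>i. i \<in> {1..n} \<Longrightarrow> \<bar>y i - x i\<bar> \<le> R"
    "\<And>i. \<lbrakk>i \<in> {1..n}; x i - R < y i\<rbrakk> \<Longrightarrow> score y i \<le> wins i"
    "\<And>i. \<lbrakk>i \<in> {1..n}; y i < x i + R\<rbrakk> \<Longrightarrow> wins i \<le> score y i"
    using clamped_solution[of R x] R by auto
  have box: "\<bar>y i - x i\<bar> \<le> R" if "i \<le> n" for i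
    using y(1,2) x_0 R that by (cases "i = 0") auto
  obtain i where i: "i \<le> n" "\<And>j. j \<le> n \<Longrightarrow> y j - x j \<le> y i - x i"
    using argmax_exists[of "\<lambda>j. y j - x j"] by blast
  obtain k where k: "k \<le> n" "\<And>j. j \<le> n \<Longrightarrow> y k - x k \<le> y j - x j"
    using argmax_exists[of "\<lambda>j. - (y j - x j)"] unfolding neg_le_iff_le by blast
  have i_ge: "0 \<le> y i - x i" and k_le: "y k - x k \<le> 0"
    using i(2)[of 0] k(2)[of 0] x_0 y(1) by auto
  have "score y i \<le> wins i"
  proof (cases "i = 0")
    case True
    \<comment> \<open>If vertex 0 is the maximiser, all deviations are nonpositive, so no coordinate
      is at the top of the box and every other defect has the same sign.\<close>
    have "(\<Sum>j=1..n. wins j - score y j) \<le> 0"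
    proof (rule sum_nonpos)
      fix j assume j: "j \<in> {1..n}"
      then show "wins j - score y j \<le> 0"
        using y(4)[OF j] i(2)[of j] True x_0 y(1) R by simp
    qed
    then show ?thesis using score_0_eq[of y] True by simp
  next
    case False
    then show ?thesis using i(1) i_ge R by (intro y(3)) auto
  qed
  then have up: "score y i - score x i \<le> E" using noise[OF i(1)] by simp
  have "wins k \<le> score y k"
  proof (cases "k = 0")
    case True
    have "0 \<le> (\<Sum>j=1..n. wins j - score y j)"
    proof (rule sum_nonneg)
      fix j assume j: "j \<in> {1..n}"
      then show "0 \<le> wins j - score y j"
        using y(3)[OF j] k(2)[of j] True x_0 y(1) R by simp
    qed
    then show ?thesis using score_0_eq[of y] True by simp
  next
    case False
    then show ?thesis using k(1) k_le R by (intro y(4)) auto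
  qed
  then have down: "score x k - score y k \<le> E" using noise[OF k(1)] by simp
  have osc: "(y i - x i) - (y k - x k) < R"
  proof (cases "i = k")
    case False
    have "b * m * ((y i - x i) - (y k - x k)) \<le> b * real (card (common_neighbours i k)) * ((y i - x i) - (y k - x k))"
      using common[OF i(1) k(1) False] b i_ge k_le by (intro mult_right_mono mult_left_mono) auto
    also have "\<dots> \<le> 2 * E"
      using i(1) k(1) i(2) k(2) b up down by (intro oscillation_bound incr y(1) box) auto
    also have "\<dots> < b * m * R" by (fact small)
    finally have *: "b * m * ((y i - x i) - (y k - x k)) < b * m * R" .
    \<comment> \<open>\<open>small\<close> forces \<open>b * m\<close> to be positive, because
      \<open>E\<close> bounds an absolute value and \<open>R\<close> is positive.\<close>
    have "0 \<le> E" using noise[OF i(1)] by simp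
    then have "0 < b * m * R" using small by simp
    then have "0 < b * m" using R zero_less_mult_pos2 by blast
    then show ?thesis using * mult_less_cancel_left_pos by blast
  qed (use R in simp)
  have strict: "\<bar>y j - x j\<bar> < R" if "j \<le> n" for j
    using i(2)[OF that] k(2)[OF that] osc i_ge k_le by linarith
  have "score y j = wins j" if j: "j \<in> {1..n}" for j
    using y(3,4)[OF j] strict[of j] j by (simp add: abs_less_iff)
  then have "moment_solution n F t a y"
    by (simp add: moment_solution_iff y(1))
  then show thesis using that box by blast
qed

text \<open>Only \<open>x\<close> is known to have positive slopes at its differences;
  \<open>y\<close> is arbitrary. Both have the same scores, so at an extremum of
  \<open>y - x\<close> terms of one sign sum to zero and each vanishes. Equal values of
  \<open>F\<close> then give equal differences along edges, and a common neighbour makes the maximum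
  and the minimum coincide.\<close>

lemma moment_solution_unique:
  assumes x: "moment_solution n F t a x" and y: "moment_solution n F t a y"
    and deriv_pos: "\<And>i j. \<lbrakk>i \<le> n; j \<le> n\<rbrakk> \<Longrightarrow> \<exists>d>0. (F has_real_derivative d) (at (x i - x j))"
    and common: "\<And>i k. \<lbrakk>i \<le> n; k \<le> n; i \<noteq> k\<rbrakk> \<Longrightarrow> common_neighbours i k \<noteq> {}"
    and j: "j \<le> n"
  shows "y j = x j"
proof -
  \<comment> \<open>The derivative gives strict increase only near \<open>x i - x j\<close>;
    monotonicity carries the strict inequality from there to a distant \<open>q\<close>.\<close>
  have inj: "q = x i - x j" if "i \<le> n" "j \<le> n" "F q = F (x i - x j)" for i j q
  proof -
    note ij = that
    let ?p = "x i - x j"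
    obtain d where d: "0 < d" "(F has_real_derivative d) (at ?p)"
      using deriv_pos[OF ij(1,2)] by auto
    obtain e1 where e1: "0 < e1" "\<And>h. \<lbrakk>0 < h; h < e1\<rbrakk> \<Longrightarrow> F ?p < F (?p + h)"
      using DERIV_pos_inc_right[OF d(2,1)] by blast
    obtain e2 where e2: "0 < e2" "\<And>h. \<lbrakk>0 < h; h < e2\<rbrakk> \<Longrightarrow> F (?p - h) < F ?p"
      using DERIV_pos_inc_left[OF d(2,1)] by blast
    consider "q = ?p" | "?p < q" | "q < ?p" by linarith
    then show ?thesis
    proof cases
      case 2
      define h where "h = min (e1 / 2) (q - ?p)"
      have "0 < h" "h < e1" "?p + h \<le> q" using 2 e1 by (auto simp: h_def)
      then have "F ?p < F q" using e1(2)[of h] monoD[OF F_mono, of "?p + h" q] by simp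
      then show ?thesis using ij by simp
    next
      case 3
      define h where "h = min (e2 / 2) (?p - q)"
      have "0 < h" "h < e2" "q \<le> ?p - h" using 3 e2 by (auto simp: h_def)
      then have "F q < F ?p" using e2(2)[of h] monoD[OF F_mono, of q "?p - h"] by simp
      then show ?thesis using ij by simp
    qed simp
  qed
  obtain i where i: "i \<le> n" "\<And>j. j \<le> n \<Longrightarrow> y j - x j \<le> y i - x i"
    using argmax_exists[of "\<lambda>j. y j - x j"] by blast
  obtain k where k: "k \<le> n" "\<And>j. j \<le> n \<Longrightarrow> y k - x k \<le> y j - x j"
    using argmax_exists[of "\<lambda>j. - (y j - x j)"] unfolding neg_le_iff_le by blast
  have eq: "real (t l j) * (F (y l - y j) - F (x l - x j)) = 0" 
    if "l \<le> n" "j \<le> n" 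
      "(\<forall>j\<le>n. x l - x j \<le> y l - y j) \<or> (\<forall>j\<le>n. y l - y j \<le> x l - x j)" for l j
  proof -
    let ?f = "\<lambda>j. real (t l j) * (F (y l - y j) - F (x l - x j))"
    have 0: "(\<Sum>j=0..n. ?f j) = 0"
      using score_solution[OF x that(1)] score_solution[OF y that(1)]
      by (simp add: score_def sum_subtractf right_diff_distrib)
    show ?thesis using that(3)
    proof
      assume le: "\<forall>j\<le>n. x l - x j \<le> y l - y j"
      have "0 \<le> ?f j'" if "j' \<in> {0..n}" for j'
        using monoD[OF F_mono, of "x l - x j'" "y l - y j'"] that le by simp
      then show ?thesis
        using sum_nonneg_0[of "{0..n}" ?f j] 0 \<open>j \<le> n\<close> by force
    next
      assume ge: "\<forall>j\<le>n. y l - y j \<le> x l - x j"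
      have "0 \<le> - ?f j'" if "j' \<in> {0..n}" for j'
        using monoD[OF F_mono, of "y l - y j'" "x l - x j'"] that ge
        by (simp add: mult_nonneg_nonpos)
      moreover have "(\<Sum>j=0..n. - ?f j) = 0" using 0 by (simp add: sum_negf)
      ultimately have "- ?f j = 0"
        using sum_nonneg_0[of "{0..n}" "\<lambda>j. - ?f j" j] \<open>j \<le> n\<close> by force
      then show ?thesis by simp
    qed
  qed
  have "y i - x i = y k - x k"
  proof (cases "i = k")
    case False
    then obtain j where j: "j \<le> n" "0 < t i j" "0 < t k j"
      using common[OF i(1) k(1)] by (auto simp: common_neighbours_def)
    have "\<forall>j\<le>n. x i - x j \<le> y i - y j"
    proof (intro allI impI)
      fix j assume "j \<le> n"
      then show "x i - x j \<le> y i - y j" using i(2)[of j] by linarith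
    qed
    then have "F (y i - y j) = F (x i - x j)"
      using eq[OF i(1) j(1)] j(2) by simp
    then have 1: "y i - y j = x i - x j" using inj i(1) j(1) by blast
    have "\<forall>j\<le>n. y k - y j \<le> x k - x j"
    proof (intro allI impI)
      fix j assume "j \<le> n"
      then show "y k - y j \<le> x k - x j" using k(2)[of j] by linarith
    qed
    then have "F (y k - y j) = F (x k - x j)"
      using eq[OF k(1) j(1)] j(3) by simp
    then have "y k - y j = x k - x j" using inj k(1) j(1) by blast
    with 1 show ?thesis by simp
  qed simp
  moreover have "x 0 = 0" "y 0 = 0" using x y by (auto simp: moment_solution_iff)
  ultimately show ?thesis
    using i(2)[OF j] k(2)[OF j] i(2)[of 0] k(2)[of 0] by simp
qed

end

subsection \<open>Concentration of the wins and of the number of common neighbours\<close>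

text \<open>Such an event is a countable union of joint fibres, whatever quantifiers over real
  vectors \<open>P\<close> contains. This makes solvability of the moment equations an
  event.\<close>

lemma discrete_event_measurable:
  fixes X :: "'i \<Rightarrow> 'a \<Rightarrow> 'b :: countable"
  assumes I: "finite I"
    and X: "\<And>i. i \<in> I \<Longrightarrow> X i \<in> measurable M (count_space UNIV)"
    and P: "\<And>f g. (\<And>i. i \<in> I \<Longrightarrow> f i = g i) \<Longrightarrow> P f \<longleftrightarrow> P g"
  shows "{\<omega> \<in> space M. P (\<lambda>i. X i \<omega>)} \<in> sets M"
proof -
  let ?C = "{f \<in> PiE I (\<lambda>_. UNIV). P f}"
  have "countable (PiE I (\<lambda>_. UNIV :: 'b set))"
    by (intro countable_PiE I) auto
  then have "countable ?C" by (rule countable_subset[rotated]) auto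
  moreover have "{\<omega> \<in> space M. \<forall>i\<in>I. X i \<omega> = f i} \<in> sets M" for f
  proof (intro sets.sets_Collect_countable_All' countable_finite I)
    fix i assume "i \<in> I"
    then have "X i -` {f i} \<inter> space M \<in> sets M" using X by (intro measurable_sets[OF X]) auto
    also have "X i -` {f i} \<inter> space M = {\<omega> \<in> space M. X i \<omega> = f i}" by auto
    finally show "{\<omega> \<in> space M. X i \<omega> = f i} \<in> sets M" .
  qed
  ultimately have "(\<Union>f\<in>?C. {\<omega> \<in> space M. \<forall>i\<in>I. X i \<omega> = f i}) \<in> sets M"
    by (intro sets.countable_UN'') auto
  also have "(\<Union>f\<in>?C. {\<omega> \<in> space M. \<forall>i\<in>I. X i \<omega> = f i}) = {\<omega> \<in> space M. P (\<lambda>i. X i \<omega>)}"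
  proof (intro set_eqI iffI)
    fix \<omega> assume "\<omega> \<in> (\<Union>f\<in>?C. {\<omega> \<in> space M. \<forall>i\<in>I. X i \<omega> = f i})"
    then obtain f where "P f" "\<omega> \<in> space M" "\<forall>i\<in>I. X i \<omega> = f i" by auto
    then show "\<omega> \<in> {\<omega> \<in> space M. P (\<lambda>i. X i \<omega>)}" using P[of f "\<lambda>i. X i \<omega>"] by auto
  next
    fix \<omega> assume "\<omega> \<in> {\<omega> \<in> space M. P (\<lambda>i. X i \<omega>)}"
    moreover have "P (restrict (\<lambda>i. X i \<omega>) I) \<longleftrightarrow> P (\<lambda>i. X i \<omega>)" by (rule P) simp
    ultimately show "\<omega> \<in> (\<Union>f\<in>?C. {\<omega> \<in> space M. \<forall>i\<in>I. X i \<omega> = f i})"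
      by (intro UN_I[of "restrict (\<lambda>i. X i \<omega>) I"]) auto
  qed
  finally show ?thesis .
qed

lemma expectation_binomial_pmf:
  assumes "q \<in> {0..1}"
  shows "measure_pmf.expectation (binomial_pmf k q) real = real k * q"
proof -
  have "measure_pmf.expectation (binomial_pmf k q) real = (\<Sum>i\<le>k. real i * Bernstein k i q)"
    unfolding expectation_binomial_pmf'[OF assms] by (intro sum.cong) (auto simp: Bernstein_def)
  then show ?thesis by simp
qed

lemma binomial_pmf_prob_gt:
  assumes "q \<in> {0..1}"
  shows "measure_pmf.prob (binomial_pmf k q) {k<..} = 0"
  using assms by (auto simp: measure_pmf_zero_iff set_pmf_binomial_eq split: if_splits)

lemma binomial_pmf_prob_pos_ge:
  assumes "0 < q" "q \<le> 1" "1 \<le> k"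
  shows "q \<le> measure_pmf.prob (binomial_pmf k q) {0<..}"
proof -
  have "measure_pmf.prob (binomial_pmf k q) {0<..} = 1 - measure_pmf.prob (binomial_pmf k q) {0}"
  proof -
    have "{0<..} = UNIV - {0 :: nat}" by auto
    then show ?thesis using measure_pmf.prob_compl[of "{0}" "binomial_pmf k q"] by simp
  qed
  also have "measure_pmf.prob (binomial_pmf k q) {0} = (1 - q) ^ k"
    using assms by (simp add: measure_pmf_single)
  finally show ?thesis
    using power_decreasing[of 1 k "1 - q"] assms by simp
qed

text \<open>The model indexes independence by pairs \<open>i < j\<close>; this is the canonical
  index of an edge.\<close>

definition unordered :: "nat \<Rightarrow> nat \<Rightarrow> nat \<times> nat" where
  "unordered i j = (min i j, max i j)"

lemma unordered_eq_iff:
  "unordered i j = unordered k l \<longleftrightarrow> (i = k \<and> j = l) \<or> (i = l \<and> j = k)"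
  by (auto simp: unordered_def min_def max_def split: if_splits)

section \<open>Measurability and conditioning on the comparison counts\<close>

context paired_comparison
begin

definition pairs :: "(nat \<times> nat) set" where
  "pairs = {(i, j). i < j \<and> j \<le> n}"

lemma finite_pairs: "finite pairs"
  by (rule finite_subset[of _ "{..n} \<times> {..n}"]) (auto simp: pairs_def)

lemma unordered_in_pairs: "\<lbrakk>i \<le> n; j \<le> n; i \<noteq> j\<rbrakk> \<Longrightarrow> unordered i j \<in> pairs"
  by (auto simp: unordered_def pairs_def)

lemma t_unordered:
  "\<lbrakk>i \<le> n; j \<le> n; \<omega> \<in> space M\<rbrakk> \<Longrightarrow> t (fst (unordered i j)) (snd (unordered i j)) \<omega> = t i j \<omega>"
  using t_sym[of i j \<omega>] by (auto simp: unordered_def min_def max_def)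

lemma t_indep_pairs: "indep_vars (\<lambda>_. count_space UNIV) (\<lambda>(i, j). t i j) pairs"
  using t_indep by (simp add: pairs_def)

lemma t_measurable:
  assumes "i \<le> n" "j \<le> n"
  shows "t i j \<in> measurable M (count_space UNIV)"
proof (cases "i = j")
  case True
  have "t i j \<in> measurable M (count_space UNIV) \<longleftrightarrow> (\<lambda>_. 0 :: nat) \<in> measurable M (count_space UNIV)"
    using True assms t_diag by (intro measurable_cong) auto
  then show ?thesis by simp
next
  case False
  have "(\<lambda>(i, j). t i j) (unordered i j) \<in> measurable M (count_space UNIV)"
    using t_indep_pairs unordered_in_pairs[OF assms False] unfolding indep_vars_def by blast
  also have "?this \<longleftrightarrow> ?thesis"
    using assms t_unordered by (intro measurable_cong) (auto simp: case_prod_beta)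
  finally show ?thesis .
qed

lemma t_event:
  assumes "i \<le> n" "j \<le> n"
  shows "{\<omega> \<in> space M. Q (t i j \<omega>)} \<in> sets M"
proof -
  have "t i j -` {x. Q x} \<inter> space M \<in> sets M"
    by (rule measurable_sets[OF t_measurable]) (use assms in auto)
  also have "t i j -` {x. Q x} \<inter> space M = {\<omega> \<in> space M. Q (t i j \<omega>)}" by auto
  finally show ?thesis .
qed

lemma prob_t:
  assumes "i < j" "j \<le> n"
  shows "prob {\<omega> \<in> space M. t i j \<omega> \<in> A} = measure_pmf.prob (binomial_pmf T p) A"
proof -
  have "measure_pmf.prob (binomial_pmf T p) A = measure (distr M (count_space UNIV) (t i j)) A"
    using t_binomial[OF assms] by simp
  also have "\<dots> = prob (t i j -` A \<inter> space M)"
    using assms by (intro measure_distr t_measurable) auto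
  also have "t i j -` A \<inter> space M = {\<omega> \<in> space M. t i j \<omega> \<in> A}" by auto
  finally show ?thesis by simp
qed

lemma p_in: "p \<in> {0..1}"
  using p_pos p_le_1 by simp

definition realisation :: "(nat \<Rightarrow> nat \<Rightarrow> nat) \<Rightarrow> 'a set" where
  "realisation \<tau> = {\<omega> \<in> space M. \<forall>i j. i < j \<and> j \<le> n \<longrightarrow> t i j \<omega> = \<tau> i j}"

lemma realisation_pairs: "realisation \<tau> = {\<omega> \<in> space M. \<forall>(i, j)\<in>pairs. t i j \<omega> = \<tau> i j}"
  by (auto simp: realisation_def pairs_def)

lemma realisation_sets [measurable]: "realisation \<tau> \<in> sets M"
  unfolding realisation_pairs case_prod_beta
  by (intro sets.sets_Collect_countable_All' countable_finite finite_pairs t_event) (auto simp: pairs_def)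

lemma realisation_le_T:
  assumes "0 < prob (realisation \<tau>)" "i < j" "j \<le> n"
  shows "\<tau> i j \<le> T"
proof (rule ccontr)
  assume "\<not> \<tau> i j \<le> T"
  then have "prob (realisation \<tau>) \<le> prob {\<omega> \<in> space M. t i j \<omega> \<in> {T<..}}"
    using assms by (intro finite_measure_mono t_event) (auto simp: realisation_def)
  then show False
    using assms prob_t[of i j "{T<..}"] binomial_pmf_prob_gt[OF p_in, of T] by simp
qed

text \<open>A finite index set for realisations that carry all the mass. Extensionality outside
  \<open>pairs\<close> makes distinct indices differ on some pair, so that their events are
  disjoint.\<close>

definition bounded_counts :: "(nat \<times> nat \<Rightarrow> nat) set" where
  "bounded_counts = PiE pairs (\<lambda>_. {..T})"

lemma finite_bounded_counts: "finite bounded_counts"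
  unfolding bounded_counts_def by (intro finite_PiE finite_pairs) auto

lemma disjoint_realisations: "disjoint_family_on (\<lambda>g. realisation (curry g)) bounded_counts"
proof (unfold disjoint_family_on_def, intro ballI impI)
  fix g h assume gh: "g \<in> bounded_counts" "h \<in> bounded_counts" "g \<noteq> h"
  then obtain q where "q \<in> pairs" "g q \<noteq> h q"
    unfolding bounded_counts_def by (metis PiE_ext)
  then show "realisation (curry g) \<inter> realisation (curry h) = {}"
    by (force simp: realisation_pairs)
qed

lemma AE_bounded_counts: "AE \<omega> in M. \<omega> \<in> (\<Union>g\<in>bounded_counts. realisation (curry g))"
proof -
  have "AE \<omega> in M. \<forall>q\<in>pairs. t (fst q) (snd q) \<omega> \<le> T"
  proof (rule AE_finite_allI[OF finite_pairs])
    fix q assume q: "q \<in> pairs"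
    then have "prob {\<omega> \<in> space M. t (fst q) (snd q) \<omega> \<in> {T<..}} = 0"
      using prob_t[of "fst q" "snd q" "{T<..}"] binomial_pmf_prob_gt[OF p_in, of T]
      by (auto simp: pairs_def)
    then have "emeasure M {\<omega> \<in> space M. \<not> t (fst q) (snd q) \<omega> \<le> T} = 0"
      by (simp add: emeasure_eq_measure not_le)
    moreover have "{\<omega> \<in> space M. \<not> t (fst q) (snd q) \<omega> \<le> T} \<in> sets M"
      using q by (intro t_event) (auto simp: pairs_def)
    ultimately show "AE \<omega> in M. t (fst q) (snd q) \<omega> \<le> T"
      by (subst AE_iff_measurable[OF _ refl]) auto
  qed
  then show ?thesis
  proof (rule AE_mp, intro AE_I2 impI)
    fix \<omega> assume \<omega>: "\<omega> \<in> space M" "\<forall>q\<in>pairs. t (fst q) (snd q) \<omega> \<le> T"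
    let ?g = "restrict (\<lambda>q. t (fst q) (snd q) \<omega>) pairs"
    have "?g \<in> bounded_counts" using \<omega> by (auto simp: bounded_counts_def)
    moreover have "\<omega> \<in> realisation (curry ?g)" using \<omega> by (auto simp: realisation_pairs)
    ultimately show "\<omega> \<in> (\<Union>g\<in>bounded_counts. realisation (curry g))" by blast
  qed
qed

lemma prob_eq_sum_realisations:
  assumes "A \<in> sets M"
  shows "prob A = (\<Sum>g\<in>bounded_counts. prob (A \<inter> realisation (curry g)))"
proof -
  have "prob A = prob (\<Union>g\<in>bounded_counts. A \<inter> realisation (curry g))"
  proof (rule finite_measure_eq_AE)
    show "AE \<omega> in M. (\<omega> \<in> A) = (\<omega> \<in> (\<Union>g\<in>bounded_counts. A \<inter> realisation (curry g)))"
      using AE_bounded_counts by (rule AE_mp) auto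
    show "(\<Union>g\<in>bounded_counts. A \<inter> realisation (curry g)) \<in> sets M"
      using assms finite_bounded_counts by (intro sets.finite_UN) auto
  qed fact
  also have "\<dots> = (\<Sum>g\<in>bounded_counts. prob (A \<inter> realisation (curry g)))"
    using disjoint_realisations assms
    by (intro finite_measure_finite_Union finite_bounded_counts)
       (fastforce simp: disjoint_family_on_def)+
  finally show ?thesis .
qed

lemma sum_prob_realisations: "(\<Sum>g\<in>bounded_counts. prob (realisation (curry g))) = 1"
proof -
  have *: "space M \<inter> realisation \<tau> = realisation \<tau>" for \<tau>
    using sets.sets_into_space[OF realisation_sets, of \<tau>] by (rule Int_absorb1)
  show ?thesis
    using prob_eq_sum_realisations[OF sets.top] unfolding prob_space * by (rule sym)
qed

text \<open>The law of total probability; realisations of probability zero contribute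
  nothing.\<close>

lemma prob_le_of_conditional:
  assumes A: "A \<in> sets M"
    and c: "\<And>\<tau>. 0 < prob (realisation \<tau>) \<Longrightarrow> measure (uniform_measure M (realisation \<tau>)) A \<le> c"
  shows "prob A \<le> c"
proof -
  have "prob (A \<inter> realisation \<tau>) \<le> c * prob (realisation \<tau>)" for \<tau>
  proof (cases "0 < prob (realisation \<tau>)")
    case True
    then have "measure (uniform_measure M (realisation \<tau>)) A = prob (realisation \<tau> \<inter> A) / prob (realisation \<tau>)"
      using A by (intro measure_uniform_measure) (auto simp: emeasure_eq_measure)
    then show ?thesis using c[OF True] True by (simp add: divide_le_eq Int_commute)
  next
    case False
    have "prob (A \<inter> realisation \<tau>) \<le> prob (realisation \<tau>)"
      by (intro finite_measure_mono) auto
    then show ?thesis using False by (simp add: not_less measure_le_0_iff)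
  qed
  then have "prob A \<le> (\<Sum>g\<in>bounded_counts. c * prob (realisation (curry g)))"
    unfolding prob_eq_sum_realisations[OF A] by (intro sum_mono)
  also have "\<dots> = c" by (simp add: sum_distrib_left[symmetric] sum_prob_realisations)
  finally show ?thesis .
qed

text \<open>The model yields measurability of the wins only under conditional measures. These share
  the events of \<open>M\<close>, and some realisation has positive probability.\<close>

lemma a_measurable:
  assumes "i \<le> n" "j \<le> n"
  shows "a i j \<in> measurable M (count_space UNIV)"
proof -
  have "\<exists>g\<in>bounded_counts. 0 < prob (realisation (curry g))"
  proof (rule ccontr)
    assume "\<not> ?thesis"
    then have "(\<Sum>g\<in>bounded_counts. prob (realisation (curry g))) \<le> 0"
      by (intro sum_nonpos) (auto simp: not_less)
    then show False by (simp add: sum_prob_realisations)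
  qed
  then obtain \<tau> where \<tau>: "0 < prob (realisation \<tau>)" by auto
  interpret U: prob_space "uniform_measure M (realisation \<tau>)"
    using \<tau> by (intro prob_space_uniform_measure) (auto simp: emeasure_eq_measure)
  have less: "a i j \<in> measurable M (count_space UNIV)" if "i < j" "j \<le> n" for i j
  proof -
    have "(\<lambda>(i, j). a i j) (i, j) \<in> measurable (uniform_measure M (realisation \<tau>)) (count_space UNIV)"
      using a_cond_indep[OF realisation_def \<tau>] that unfolding U.indep_vars_def by blast
    also have "measurable (uniform_measure M (realisation \<tau>)) (count_space UNIV) = measurable M (count_space UNIV)"
      by (intro measurable_cong_sets) auto
    finally show ?thesis by simp
  qed
  consider "i < j" | "i = j" | "j < i" by linarith
  then show ?thesis
  proof cases
    case 2
    have "a i j \<in> measurable M (count_space UNIV) \<longleftrightarrow> (\<lambda>_. 0 :: nat) \<in> measurable M (count_space UNIV)"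
      using 2 assms a_diag by (intro measurable_cong) auto
    then show ?thesis by simp
  next
    case 3
    have [measurable]: "a j i \<in> measurable M (count_space UNIV)" "t j i \<in> measurable M (count_space UNIV)"
      using less[OF 3 assms(1)] t_measurable[OF assms(2,1)] by auto
    have "a i j \<in> measurable M (count_space UNIV) \<longleftrightarrow> (\<lambda>\<omega>. t j i \<omega> - a j i \<omega>) \<in> measurable M (count_space UNIV)"
    proof (rule measurable_cong)
      fix \<omega> assume "\<omega> \<in> space M"
      then show "a i j \<omega> = t j i \<omega> - a j i \<omega>" using a_total[OF 3 assms(1)] by (metis add_diff_cancel_left')
    qed
    moreover have "(\<lambda>\<omega>. t j i \<omega> - a j i \<omega>) \<in> measurable M (count_space UNIV)" by measurable
    ultimately show ?thesis by simp
  qed (use less assms in auto)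
qed

lemma a_total_all:
  assumes "i \<le> n" "j \<le> n" "\<omega> \<in> space M"
  shows "a i j \<omega> + a j i \<omega> = t i j \<omega>"
  using assms a_total[of i j \<omega>] a_total[of j i \<omega>] t_sym[of i j \<omega>] t_diag[of i \<omega>] a_diag[of i \<omega>]
  by (cases i j rule: linorder_cases) auto

lemma count_event_measurable:
  assumes cong: "\<And>\<tau> \<tau>' \<alpha> \<alpha>'. \<lbrakk>\<And>i j. \<lbrakk>i \<le> n; j \<le> n\<rbrakk> \<Longrightarrow> \<tau> i j = \<tau>' i j; \<And>i j. \<lbrakk>i \<le> n; j \<le> n\<rbrakk> \<Longrightarrow> \<alpha> i j = \<alpha>' i j\<rbrakk>
    \<Longrightarrow> P \<tau> \<alpha> \<longleftrightarrow> P \<tau>' \<alpha>'"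
  shows "{\<omega> \<in> space M. P (\<lambda>i j. t i j \<omega>) (\<lambda>i j. a i j \<omega>)} \<in> sets M"
proof -
  \<comment> \<open>A Boolean tag merges the two arrays of counts into one finite family.\<close>
  let ?X = "\<lambda>(b, i, j). if b then t i j else a i j"
  have "{\<omega> \<in> space M. (\<lambda>f. P (\<lambda>i j. f (True, i, j)) (\<lambda>i j. f (False, i, j))) (\<lambda>q. ?X q \<omega>)} \<in> sets M"
  proof (rule discrete_event_measurable[where I = "UNIV \<times> {..n} \<times> {..n}" and X = ?X
      and P = "\<lambda>f. P (\<lambda>i j. f (True, i, j)) (\<lambda>i j. f (False, i, j))"])
    fix f g :: "bool \<times> nat \<times> nat \<Rightarrow> nat"
    assume "\<And>q. q \<in> UNIV \<times> {..n} \<times> {..n} \<Longrightarrow> f q = g q"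
    then show "P (\<lambda>i j. f (True, i, j)) (\<lambda>i j. f (False, i, j)) = P (\<lambda>i j. g (True, i, j)) (\<lambda>i j. g (False, i, j))"
      by (intro cong) auto
  qed (auto simp: t_measurable a_measurable split: prod.split)
  then show ?thesis by simp
qed

section \<open>Hoeffding bounds for the noise and for common neighbours\<close>

lemma conditional_noise_bound:
  assumes F01: "\<And>x. 0 \<le> F x \<and> F x \<le> 1" and F_sym: "\<And>x. F x = 1 - F (- x)"
    and n: "1 \<le> n" and T: "1 \<le> T" and i: "i \<le> n" and s: "0 \<le> s"
    and \<tau>: "0 < prob (realisation \<tau>)"
  shows "measure (uniform_measure M (realisation \<tau>))
      {\<omega> \<in> space M. s \<le> \<bar>\<Sum>j=0..n. real (a i j \<omega>) - real (t i j \<omega>) * F (\<beta>s i - \<beta>s j)\<bar>}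
    \<le> 2 * exp (- s\<^sup>2 / (2 * real n * (real T)\<^sup>2))"
proof -
  let ?U = "uniform_measure M (realisation \<tau>)"
  interpret U: prob_space ?U
    using \<tau> by (intro prob_space_uniform_measure) (auto simp: emeasure_eq_measure)
  define I where "I = unordered i ` ({0..n} - {i})"
  have inj: "inj_on (unordered i) ({0..n} - {i})"
    by (auto simp: inj_on_def unordered_eq_iff)
  have I_pairs: "I \<subseteq> pairs"
    unfolding I_def using i by (intro image_subsetI unordered_in_pairs) auto
  have card_I: "card I = n" using i by (simp add: I_def card_image[OF inj])
  \<comment> \<open>Only the variable with the smaller index first is controlled by the model. If
    \<open>i\<close> is the larger index, \<open>a i j = t i j - a j i\<close> and the symmetry of
    \<open>F\<close> turn its centred wins into minus those of the opponent.\<close>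
  define Y where "Y q x = (if fst q = i then 1 else - 1) *
    (real x - real (\<tau> (fst q) (snd q)) * F (\<beta>s (fst q) - \<beta>s (snd q)))" for q x
  define X where "X q \<omega> = Y q (a (fst q) (snd q) \<omega>)" for q \<omega>
  have U_AE: "AE \<omega> in ?U. \<omega> \<in> realisation \<tau>"
    by (rule AE_uniform_measureI) auto
  have "U.indep_vars (\<lambda>_. count_space UNIV) (\<lambda>(i, j). a i j) pairs"
    using a_cond_indep[OF realisation_def \<tau>] by (simp add: pairs_def)
  then have "U.indep_vars (\<lambda>_. borel) (\<lambda>q \<omega>. Y q ((\<lambda>(i, j). a i j) q \<omega>)) pairs"
    by (rule U.indep_vars_compose2) auto
  then have indep: "U.indep_vars (\<lambda>_. borel) X I"
    using U.indep_vars_subset[OF _ I_pairs] unfolding X_def by (simp add: case_prod_beta)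
  have bnd: "AE \<omega> in ?U. X q \<omega> \<in> {- real T..real T}" if "q \<in> I" for q
  proof -
    have q: "fst q < snd q" "snd q \<le> n" using that I_pairs by (auto simp: pairs_def)
    have \<tau>_T: "\<tau> (fst q) (snd q) \<le> T" by (rule realisation_le_T[OF \<tau> q])
    show ?thesis
    proof (rule AE_mp[OF U_AE], intro AE_I2 impI)
      fix \<omega> assume \<omega>: "\<omega> \<in> realisation \<tau>"
      then have "a (fst q) (snd q) \<omega> \<le> \<tau> (fst q) (snd q)"
        using a_total[OF q, of \<omega>] q by (auto simp: realisation_def)
      then have 1: "real (a (fst q) (snd q) \<omega>) \<le> real T" using \<tau>_T by linarith
      have "real (\<tau> (fst q) (snd q)) * F (\<beta>s (fst q) - \<beta>s (snd q)) \<le> real T * 1"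
        using \<tau>_T F01 by (intro mult_mono) auto
      moreover have "0 \<le> real (\<tau> (fst q) (snd q)) * F (\<beta>s (fst q) - \<beta>s (snd q))"
        using F01 by simp
      ultimately show "X q \<omega> \<in> {- real T..real T}"
        using 1 unfolding X_def Y_def by auto
    qed
  qed
  have exp_0: "U.expectation (X q) = 0" if "q \<in> I" for q
  proof -
    have q: "fst q < snd q" "snd q \<le> n" using that I_pairs by (auto simp: pairs_def)
    let ?p = "F (\<beta>s (fst q) - \<beta>s (snd q))" and ?k = "\<tau> (fst q) (snd q)"
    have p01: "?p \<in> {0..1}" using F01 by simp
    have a_meas: "a (fst q) (snd q) \<in> measurable ?U (count_space UNIV)"
      using a_measurable[of "fst q" "snd q"] q by (simp add: measurable_def)
    have "U.expectation (X q) = integral\<^sup>L (distr ?U (count_space UNIV) (a (fst q) (snd q))) (Y q)"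
      unfolding X_def using a_meas by (subst integral_distr) auto
    also have "\<dots> = measure_pmf.expectation (binomial_pmf ?k ?p) (Y q)"
      using a_cond_binomial[OF realisation_def \<tau> q] by simp
    also have "\<dots> = (if fst q = i then 1 else - 1) * (measure_pmf.expectation (binomial_pmf ?k ?p) real - real ?k * ?p)"
      unfolding Y_def using p01 by simp
    also have "\<dots> = 0" by (simp add: expectation_binomial_pmf[OF p01])
    finally show ?thesis .
  qed
  interpret H: Hoeffding_ineq ?U I X "\<lambda>_. - real T" "\<lambda>_. real T" "\<Sum>q\<in>I. U.expectation (X q)"
    by unfold_locales (use indep bnd in \<open>auto simp: I_def\<close>)
  \<comment> \<open>There are \<open>n\<close> summands with range \<open>2 T\<close>, so the
    exponent is \<open>2 s^2 / (4 n T^2)\<close>.\<close>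
  have "measure ?U {\<omega> \<in> space ?U. s \<le> \<bar>(\<Sum>q\<in>I. X q \<omega>) - (\<Sum>q\<in>I. U.expectation (X q))\<bar>}
      \<le> 2 * exp (- 2 * s\<^sup>2 / (\<Sum>q\<in>I. (real T - - real T)\<^sup>2))"
    using n T by (intro H.Hoeffding_ineq_abs_ge s) (simp add: card_I)
  also have "- 2 * s\<^sup>2 / (\<Sum>q\<in>I. (real T - - real T)\<^sup>2) = - s\<^sup>2 / (2 * real n * (real T)\<^sup>2)"
    using n T by (simp add: card_I power2_eq_square field_simps)
  finally have hoeff: "measure ?U {\<omega> \<in> space M. s \<le> \<bar>\<Sum>q\<in>I. X q \<omega>\<bar>} \<le> 2 * exp (- s\<^sup>2 / (2 * real n * (real T)\<^sup>2))"
    by (simp add: exp_0)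
  have sum_eq: "(\<Sum>j=0..n. real (a i j \<omega>) - real (t i j \<omega>) * F (\<beta>s i - \<beta>s j)) = (\<Sum>q\<in>I. X q \<omega>)"
    if \<omega>: "\<omega> \<in> realisation \<tau>" for \<omega>
  proof -
    have \<omega>M: "\<omega> \<in> space M" using \<omega> by (simp add: realisation_def)
    have "(\<Sum>q\<in>I. X q \<omega>) = (\<Sum>j\<in>{0..n}-{i}. X (unordered i j) \<omega>)"
      unfolding I_def by (simp add: sum.reindex[OF inj])
    also have "\<dots> = (\<Sum>j\<in>{0..n}-{i}. real (a i j \<omega>) - real (t i j \<omega>) * F (\<beta>s i - \<beta>s j))"
    proof (rule sum.cong[OF refl])
      fix j assume j: "j \<in> {0..n} - {i}"
      show "X (unordered i j) \<omega> = real (a i j \<omega>) - real (t i j \<omega>) * F (\<beta>s i - \<beta>s j)"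
      proof (cases "i < j")
        case True
        then show ?thesis using \<omega> j by (simp add: X_def Y_def unordered_def realisation_def)
      next
        case False
        then have "j < i" using j by auto
        then have "t i j \<omega> = \<tau> j i" "real (a i j \<omega>) = real (t i j \<omega>) - real (a j i \<omega>)"
          using \<omega> t_sym[of i j \<omega>] a_total_all[of i j \<omega>] i j \<omega>M by (auto simp: realisation_def)
        then show ?thesis
          using \<open>j < i\<close> F_sym[of "\<beta>s i - \<beta>s j"] by (simp add: X_def Y_def unordered_def right_diff_distrib)
      qed
    qed
    also have "\<dots> = (\<Sum>j=0..n. real (a i j \<omega>) - real (t i j \<omega>) * F (\<beta>s i - \<beta>s j))"
      using i t_diag[OF i \<omega>M] a_diag[OF i \<omega>M] by (simp add: sum.remove[of "{0..n}" i])
    finally show ?thesis by simp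
  qed
  have "measure ?U {\<omega> \<in> space M. s \<le> \<bar>\<Sum>j=0..n. real (a i j \<omega>) - real (t i j \<omega>) * F (\<beta>s i - \<beta>s j)\<bar>}
      \<le> measure ?U {\<omega> \<in> space M. s \<le> \<bar>\<Sum>q\<in>I. X q \<omega>\<bar>}"
  proof (rule U.finite_measure_mono_AE)
    show "AE \<omega> in ?U. \<omega> \<in> {\<omega> \<in> space M. s \<le> \<bar>\<Sum>j=0..n. real (a i j \<omega>) - real (t i j \<omega>) * F (\<beta>s i - \<beta>s j)\<bar>}
      \<longrightarrow> \<omega> \<in> {\<omega> \<in> space M. s \<le> \<bar>\<Sum>q\<in>I. X q \<omega>\<bar>}"
      by (rule AE_mp[OF U_AE], rule AE_I2) (auto simp: sum_eq)
    have "(\<lambda>\<omega>. \<Sum>q\<in>I. X q \<omega>) \<in> borel_measurable ?U"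
      using H.random_variable by (intro borel_measurable_sum)
    then have "{\<omega> \<in> space ?U. s \<le> \<bar>\<Sum>q\<in>I. X q \<omega>\<bar>} \<in> sets ?U" by measurable
    then show "{\<omega> \<in> space M. s \<le> \<bar>\<Sum>q\<in>I. X q \<omega>\<bar>} \<in> sets ?U" by simp
  qed
  then show ?thesis using hoeff by linarith
qed

lemma noise_bound:
  assumes F01: "\<And>x. 0 \<le> F x \<and> F x \<le> 1" and F_sym: "\<And>x. F x = 1 - F (- x)"
    and n: "1 \<le> n" and T: "1 \<le> T" and i: "i \<le> n" and s: "0 \<le> s"
  shows "prob {\<omega> \<in> space M. s \<le> \<bar>\<Sum>j=0..n. real (a i j \<omega>) - real (t i j \<omega>) * F (\<beta>s i - \<beta>s j)\<bar>}
    \<le> 2 * exp (- s\<^sup>2 / (2 * real n * (real T)\<^sup>2))"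
proof (rule prob_le_of_conditional)
  show "{\<omega> \<in> space M. s \<le> \<bar>\<Sum>j=0..n. real (a i j \<omega>) - real (t i j \<omega>) * F (\<beta>s i - \<beta>s j)\<bar>} \<in> sets M"
    using i
    by (intro count_event_measurable[where P = "\<lambda>\<tau> \<alpha>. s \<le> \<bar>\<Sum>j=0..n. real (\<alpha> i j) - real (\<tau> i j) * F (\<beta>s i - \<beta>s j)\<bar>"])
       (auto intro!: arg_cong[where f = "\<lambda>x. s \<le> \<bar>x\<bar>"] sum.cong)
qed (rule conditional_noise_bound[OF assms])

text \<open>Each of the \<open>n - 1\<close> vertices other than \<open>i\<close> and
  \<open>k\<close> is a common neighbour with probability at least \<open>p^2\<close>,
  independently. A lower deviation by half of the resulting mean bound gives the exponent in
  \<open>p^4\<close>.\<close>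

lemma few_common_neighbours:
  assumes T: "1 \<le> T" and n: "2 \<le> n" and i: "i \<le> n" and k: "k \<le> n" and ik: "i \<noteq> k"
  shows "prob {\<omega> \<in> space M. real (card {j. j \<le> n \<and> 0 < t i j \<omega> \<and> 0 < t k j \<omega>}) \<le> (real n - 1) * p\<^sup>2 / 2}
    \<le> exp (- (real n - 1) * p ^ 4 / 2)"
proof -
  define J where "J = {0..n} - {i, k}"
  have card_J: "real (card J) = real n - 1"
    using i k ik n by (simp add: J_def card_Diff_subset)
  define K where "K j = {unordered i j, unordered k j}" for j
  define Y where "Y j f = (if 0 < f (unordered i j) \<and> 0 < f (unordered k j) then 1 else 0 :: real)"
    for j and f :: "nat \<times> nat \<Rightarrow> nat"
  \<comment> \<open>Factoring \<open>X j\<close> through the block of edges \<open>K j\<close> makes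
    independence of disjoint blocks applicable; blocks share no edge since \<open>J\<close> omits
    \<open>i\<close> and \<open>k\<close>.\<close>
  define X where "X j \<omega> = Y j (restrict (\<lambda>q. (\<lambda>(i, j). t i j) q \<omega>) (K j))" for j \<omega>
  have X_eq: "X j \<omega> = (if 0 < t i j \<omega> \<and> 0 < t k j \<omega> then 1 else 0)" if "j \<le> n" "\<omega> \<in> space M" for j \<omega>
    using that t_unordered[OF i that] t_unordered[OF k that]
    by (simp add: X_def Y_def K_def case_prod_beta)
  have K: "K j \<subseteq> pairs" if "j \<in> J" for j
    using that i k unordered_in_pairs by (auto simp: K_def J_def)
  have "indep_vars (\<lambda>j. PiM (K j) (\<lambda>_. count_space UNIV)) (\<lambda>j \<omega>. restrict (\<lambda>q. (\<lambda>(i, j). t i j) q \<omega>) (K j)) J"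
  proof (rule indep_vars_restrict[OF t_indep_pairs K])
    show "disjoint_family_on K J"
      using ik by (auto simp: disjoint_family_on_def K_def J_def unordered_eq_iff)
  qed
  moreover have "Y j \<in> borel_measurable (PiM (K j) (\<lambda>_. count_space UNIV))" if "j \<in> J" for j
  proof -
    have [measurable]: "unordered i j \<in> K j" "unordered k j \<in> K j" by (auto simp: K_def)
    show ?thesis unfolding Y_def by measurable
  qed
  ultimately have indep: "indep_vars (\<lambda>_. borel) X J"
    unfolding X_def by (rule indep_vars_compose2)
  interpret H: Hoeffding_ineq M J X "\<lambda>_. 0" "\<lambda>_. 1" "\<Sum>j\<in>J. expectation (X j)"
    by unfold_locales (use indep in \<open>auto simp: J_def X_def Y_def\<close>)
  have exp_ge: "p\<^sup>2 \<le> expectation (X j)" if j: "j \<in> J" for j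
  proof -
    have jn: "j \<le> n" "j \<noteq> i" "j \<noteq> k" using j by (auto simp: J_def)
    have pos: "p \<le> prob {\<omega> \<in> space M. 0 < t l j \<omega>}" if "l \<le> n" "l \<noteq> j" for l
    proof -
      have "prob {\<omega> \<in> space M. 0 < t l j \<omega>} = prob {\<omega> \<in> space M. t (min l j) (max l j) \<omega> \<in> {0<..}}"
        using t_unordered[OF that(1) jn(1)] by (intro arg_cong[where f = prob]) (auto simp: unordered_def)
      also have "\<dots> = measure_pmf.prob (binomial_pmf T p) {0<..}"
        using that jn by (intro prob_t) auto
      also have "p \<le> \<dots>"
        by (intro binomial_pmf_prob_pos_ge p_pos p_le_1 T)
      finally show ?thesis .
    qed
    let ?t = "\<lambda>(i, j). t i j"
    have ne: "unordered i j \<noteq> unordered k j" using ik by (auto simp: unordered_eq_iff)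
    have pre: "?t (unordered l j) -` {0<..} \<inter> space M = {\<omega> \<in> space M. 0 < t l j \<omega>}" if "l \<le> n" for l
      using t_unordered[OF that jn(1)] by (auto simp: case_prod_beta)
    have "prob (\<Inter>q\<in>K j. ?t q -` {0<..} \<inter> space M) = (\<Prod>q\<in>K j. prob (?t q -` {0<..} \<inter> space M))"
      using K[OF j] by (intro indep_varsD[OF t_indep_pairs]) (auto simp: K_def)
    also have "\<dots> = prob {\<omega> \<in> space M. 0 < t i j \<omega>} * prob {\<omega> \<in> space M. 0 < t k j \<omega>}"
      using ne by (simp add: K_def pre[OF i] pre[OF k])
    also have "(\<Inter>q\<in>K j. ?t q -` {0<..} \<inter> space M) = {\<omega> \<in> space M. 0 < t i j \<omega> \<and> 0 < t k j \<omega>}"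
      using pre[OF i] pre[OF k] by (auto simp: K_def)
    finally have prod: "prob {\<omega> \<in> space M. 0 < t i j \<omega> \<and> 0 < t k j \<omega>} =
      prob {\<omega> \<in> space M. 0 < t i j \<omega>} * prob {\<omega> \<in> space M. 0 < t k j \<omega>}" .
    have "p * p \<le> prob {\<omega> \<in> space M. 0 < t i j \<omega>} * prob {\<omega> \<in> space M. 0 < t k j \<omega>}"
      using pos[OF i] pos[OF k] jn p_pos by (intro mult_mono) auto
    also have "\<dots> = expectation (indicator {\<omega> \<in> space M. 0 < t i j \<omega> \<and> 0 < t k j \<omega>})"
      by (simp add: prod[symmetric] Int_absorb2)
    also have "\<dots> = expectation (X j)"
      using X_eq[OF jn(1)] by (intro Bochner_Integration.integral_cong) (auto simp: indicator_def)
    finally show ?thesis by (simp add: power2_eq_square)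
  qed
  have mean: "(real n - 1) * p\<^sup>2 \<le> (\<Sum>j\<in>J. expectation (X j))"
    using sum_mono[of J "\<lambda>_. p\<^sup>2", OF exp_ge] by (simp add: card_J)
  let ?s = "(real n - 1) * p\<^sup>2 / 2"
  have "prob {\<omega> \<in> space M. real (card {j. j \<le> n \<and> 0 < t i j \<omega> \<and> 0 < t k j \<omega>}) \<le> (real n - 1) * p\<^sup>2 / 2}
      \<le> prob {\<omega> \<in> space M. (\<Sum>j\<in>J. X j \<omega>) \<le> (\<Sum>j\<in>J. expectation (X j)) - ?s}"
  proof (rule finite_measure_mono)
    show "{\<omega> \<in> space M. real (card {j. j \<le> n \<and> 0 < t i j \<omega> \<and> 0 < t k j \<omega>}) \<le> (real n - 1) * p\<^sup>2 / 2}
      \<subseteq> {\<omega> \<in> space M. (\<Sum>j\<in>J. X j \<omega>) \<le> (\<Sum>j\<in>J. expectation (X j)) - ?s}"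
    proof (intro subsetI CollectI conjI)
      fix \<omega> assume \<omega>: "\<omega> \<in> {\<omega> \<in> space M. real (card {j. j \<le> n \<and> 0 < t i j \<omega> \<and> 0 < t k j \<omega>}) \<le> (real n - 1) * p\<^sup>2 / 2}"
      then show "\<omega> \<in> space M" by simp
      have "(\<Sum>j\<in>J. X j \<omega>) = (\<Sum>j\<in>J. if 0 < t i j \<omega> \<and> 0 < t k j \<omega> then 1 else 0)"
        using \<omega> by (intro sum.cong refl X_eq) (auto simp: J_def)
      also have "\<dots> = real (card {j \<in> J. 0 < t i j \<omega> \<and> 0 < t k j \<omega>})"
        by (simp add: sum.If_cases J_def Int_def)
      also have "\<dots> \<le> real (card {j. j \<le> n \<and> 0 < t i j \<omega> \<and> 0 < t k j \<omega>})"
        by (intro of_nat_mono card_mono) (auto simp: J_def)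
      also have "\<dots> \<le> (\<Sum>j\<in>J. expectation (X j)) - ?s"
        using \<omega> mean by simp
      finally show "(\<Sum>j\<in>J. X j \<omega>) \<le> (\<Sum>j\<in>J. expectation (X j)) - ?s" .
    qed
    have [measurable]: "(\<lambda>\<omega>. \<Sum>j\<in>J. X j \<omega>) \<in> borel_measurable M"
      using H.random_variable by (intro borel_measurable_sum)
    show "{\<omega> \<in> space M. (\<Sum>j\<in>J. X j \<omega>) \<le> (\<Sum>j\<in>J. expectation (X j)) - ?s} \<in> sets M" by measurable
  qed
  also have "\<dots> \<le> exp (- 2 * ?s\<^sup>2 / (\<Sum>j\<in>J. (1 - 0)\<^sup>2))"
    using n by (intro H.Hoeffding_ineq_le) (auto simp: card_J)
  also have "- 2 * ?s\<^sup>2 / (\<Sum>j\<in>J. (1 - 0)\<^sup>2) = - (real n - 1) * p ^ 4 / 2"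
    using n by (simp add: card_J power2_eq_square power4_eq_xxxx field_simps)
  finally show ?thesis .
qed

end

subsection \<open>The rate vanishes\<close>

lemma sup_dist_leI:
  assumes "1 \<le> n" "\<And>i. i \<in> {1..n} \<Longrightarrow> \<bar>x i - y i\<bar> \<le> r"
  shows "\<bar>sup_dist n x y\<bar> \<le> r"
proof -
  have "sup_dist n x y \<in> (\<lambda>i. \<bar>x i - y i\<bar>) ` {1..n}"
    unfolding sup_dist_def using assms(1) by (intro Max_in) auto
  then show ?thesis using assms(2) by auto
qed

lemma derivative_boundsD:
  assumes bounds: "derivative_bounds n \<mu> x \<epsilon> b0 b1 b2" and n: "1 \<le> n"
    and y: "y 0 = 0" "\<And>i. i \<in> {1..n} \<Longrightarrow> \<bar>x i - y i\<bar> \<le> \<epsilon>"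
    and ij: "i \<le> n" "j \<le> n"
  shows "b0 \<le> \<bar>deriv \<mu> (y i - y j)\<bar>" "\<bar>deriv \<mu> (y i - y j)\<bar> \<le> b1"
    "\<bar>deriv (deriv \<mu>) (y i - y j)\<bar> \<le> b2"
proof -
  have "sup_dist n x y \<le> \<epsilon>" using sup_dist_leI[OF n y(2)] by (rule order.trans[OF abs_ge_self])
  then have ball: "y \<in> sup_ball n x \<epsilon>" using y(1) by (simp add: sup_ball_def)
  have fin: "finite (pair_values n f y)" for f by (simp add: pair_values_def)
  have mem: "f (y i - y j) \<in> pair_values n f y" for f
    using ij unfolding pair_values_def by (auto intro!: image_eqI[of _ _ "(i, j)"])
  have le: "b0 \<le> Min (pair_values n (\<lambda>x. \<bar>deriv \<mu> x\<bar>) y)" "Max (pair_values n (\<lambda>x. \<bar>deriv \<mu> x\<bar>) y) \<le> b1"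
    "Max (pair_values n (\<lambda>x. \<bar>deriv (deriv \<mu>) x\<bar>) y) \<le> b2"
    using bounds ball by (auto simp: derivative_bounds_def)
  show "b0 \<le> \<bar>deriv \<mu> (y i - y j)\<bar>"
    using le(1) Min_le[OF fin mem, of "\<lambda>x. \<bar>deriv \<mu> x\<bar>"] by simp
  show "\<bar>deriv \<mu> (y i - y j)\<bar> \<le> b1"
    using le(2) Max_ge[OF fin mem, of "\<lambda>x. \<bar>deriv \<mu> x\<bar>"] by simp
  show "\<bar>deriv (deriv \<mu>) (y i - y j)\<bar> \<le> b2"
    using le(3) Max_ge[OF fin mem, of "\<lambda>x. \<bar>deriv (deriv \<mu>) x\<bar>"] by simp
qed

section \<open>Slope, curvature and mass of the distribution function\<close>

locale smooth_cdf = real_distribution D for D +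
  fixes F :: "real \<Rightarrow> real"
  assumes F_cdf: "F = cdf D"
    and F_diff: "\<And>x. F differentiable (at x)"
    and F'_diff: "\<And>x. deriv F differentiable (at x)"
begin

lemma F_mono: "mono F"
  unfolding F_cdf by (intro monoI cdf_nondecreasing)

lemma F_01: "0 \<le> F x \<and> F x \<le> 1"
  unfolding F_cdf using cdf_nonneg cdf_bounded_prob by simp

lemma F_deriv: "(F has_real_derivative deriv F x) (at x)"
  using F_diff DERIV_deriv_iff_real_differentiable by blast

lemma F'_deriv: "(deriv F has_real_derivative deriv (deriv F) x) (at x)"
  using F'_diff DERIV_deriv_iff_real_differentiable by blast

lemma F'_nonneg: "0 \<le> deriv F x"
  by (rule mono_on_imp_deriv_nonneg[of UNIV F _ x]) (use F_mono F_deriv in auto)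

lemma F_MVT:
  assumes "x < y"
  obtains \<xi> where "x < \<xi>" "\<xi> < y" "F y - F x = (y - x) * deriv F \<xi>"
  using MVT2[OF assms, of F "deriv F"] F_deriv by blast

text \<open>
  \<open>F\<close> gains at most 1 over an interval of length \<open>2 / F'(0)\<close>, so its slope drops there to half the
  slope at 0.
\<close>

lemma curvature:
  assumes c: "0 < deriv F 0" and l: "l \<le> 0" "0 \<le> l + 2 / deriv F 0"
  obtains \<zeta> where "l \<le> \<zeta>" "\<zeta> \<le> l + 2 / deriv F 0" "(deriv F 0)\<^sup>2 / 4 \<le> \<bar>deriv (deriv F) \<zeta>\<bar>"
proof -
  let ?c = "deriv F 0" and ?K = "2 / deriv F 0"
  have K: "0 < ?K" using c by simp
  obtain \<xi> where \<xi>: "l < \<xi>" "\<xi> < l + ?K" "F (l + ?K) - F l = ?K * deriv F \<xi>"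
    using F_MVT[of l "l + ?K"] K by auto
  have "?K * deriv F \<xi> \<le> 1"
    using \<xi>(3) F_01[of l] F_01[of "l + ?K"] by linarith
  then have \<xi>': "deriv F \<xi> \<le> ?c / 2" using c by (simp add: field_simps)
  have "\<xi> \<noteq> 0" using \<xi>' c by auto
  have "\<bar>\<xi>\<bar> \<le> ?K" using \<xi> l by simp
  have "\<exists>\<zeta>. l \<le> \<zeta> \<and> \<zeta> \<le> l + ?K \<and> \<bar>deriv F \<xi> - deriv F 0\<bar> = \<bar>\<xi>\<bar> * \<bar>deriv (deriv F) \<zeta>\<bar>"
  proof (cases "0 < \<xi>")
    case True
    then obtain \<zeta> where "0 < \<zeta>" "\<zeta> < \<xi>" "deriv F \<xi> - deriv F 0 = (\<xi> - 0) * deriv (deriv F) \<zeta>"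
      using MVT2[of 0 \<xi> "deriv F" "deriv (deriv F)"] F'_deriv by blast
    then show ?thesis using \<xi> l by (intro exI[of _ \<zeta>]) (simp add: abs_mult)
  next
    case False
    then have "\<xi> < 0" using \<open>\<xi> \<noteq> 0\<close> by simp
    then obtain \<zeta> where "\<xi> < \<zeta>" "\<zeta> < 0" "deriv F 0 - deriv F \<xi> = (0 - \<xi>) * deriv (deriv F) \<zeta>"
      using MVT2[of \<xi> 0 "deriv F" "deriv (deriv F)"] F'_deriv by blast
    moreover from this have "\<bar>deriv F \<xi> - deriv F 0\<bar> = \<bar>\<xi>\<bar> * \<bar>deriv (deriv F) \<zeta>\<bar>"
      by (simp add: abs_minus_commute[of "deriv F \<xi>"] abs_mult)
    ultimately show ?thesis using \<xi> l by (intro exI[of _ \<zeta>]) auto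
  qed
  then obtain \<zeta> where \<zeta>: "l \<le> \<zeta>" "\<zeta> \<le> l + ?K" "\<bar>deriv F \<xi> - deriv F 0\<bar> = \<bar>\<xi>\<bar> * \<bar>deriv (deriv F) \<zeta>\<bar>"
    by auto
  \<comment> \<open>A drop of at least \<open>c / 2\<close> over a distance of at most
    \<open>2 / c\<close> needs curvature \<open>c^2 / 4\<close>.\<close>
  have "?c / 2 \<le> \<bar>\<xi>\<bar> * \<bar>deriv (deriv F) \<zeta>\<bar>"
    unfolding \<zeta>(3)[symmetric] using \<xi>' c by simp
  also have "\<dots> \<le> ?K * \<bar>deriv (deriv F) \<zeta>\<bar>"
    using \<open>\<bar>\<xi>\<bar> \<le> ?K\<close> by (intro mult_right_mono) auto
  finally have "?c\<^sup>2 / 4 \<le> \<bar>deriv (deriv F) \<zeta>\<bar>"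
    using c by (simp add: field_simps power2_eq_square)
  then show thesis using \<zeta> that by blast
qed

text \<open>The increments are the masses that \<open>D\<close> gives to disjoint intervals.\<close>

lemma sum_disjoint_increments:
  assumes I: "finite I" and \<epsilon>: "0 < \<epsilon>"
    and sep: "\<And>i j. \<lbrakk>i \<in> I; j \<in> I; i \<noteq> j\<rbrakk> \<Longrightarrow> 2 * \<epsilon> < \<bar>x i - x j\<bar>"
  shows "(\<Sum>i\<in>I. F (x i + \<epsilon>) - F (x i - \<epsilon>)) \<le> 1"
proof -
  have "(\<Sum>i\<in>I. F (x i + \<epsilon>) - F (x i - \<epsilon>)) = (\<Sum>i\<in>I. prob {x i - \<epsilon><..x i + \<epsilon>})"
    unfolding F_cdf using \<epsilon> by (intro sum.cong refl cdf_diff_eq) simp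
  also have "\<dots> = prob (\<Union>i\<in>I. {x i - \<epsilon><..x i + \<epsilon>})"
  proof (rule finite_measure_finite_Union[OF I, symmetric])
    show "disjoint_family_on (\<lambda>i. {x i - \<epsilon><..x i + \<epsilon>}) I"
      unfolding disjoint_family_on_def
    proof (intro ballI impI)
      fix i j assume "i \<in> I" "j \<in> I" "i \<noteq> j"
      then have "2 * \<epsilon> < \<bar>x i - x j\<bar>" by (rule sep)
      then show "{x i - \<epsilon><..x i + \<epsilon>} \<inter> {x j - \<epsilon><..x j + \<epsilon>} = {}"
        by (auto simp: abs_if split: if_splits)
    qed
  qed auto
  also have "\<dots> \<le> 1" by simp
  finally show ?thesis .
qed

text \<open>If two merits are within \<open>2 \<epsilon>\<close>, moving both inside the box
  realises the high-curvature point of \<open>curvature\<close> as their difference, and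
  \<open>b2\<close> sees it. Otherwise the intervals of radius \<epsilon> around the merits are
  disjoint, each of mass at least \<open>2 \<epsilon> b0\<close>.\<close>

lemma wide_box:
  assumes bounds: "derivative_bounds n F x \<epsilon> b0 b1 b2" and n: "1 \<le> n" and x: "x 0 = 0"
    and c: "0 < deriv F 0" and \<epsilon>: "2 / deriv F 0 \<le> \<epsilon>"
  shows "(deriv F 0)\<^sup>2 / 4 \<le> b2 \<or> 2 * real n * \<epsilon> * b0 \<le> 1"
proof (cases "\<exists>i\<in>{1..n}. \<exists>j\<in>{1..n}. i \<noteq> j \<and> \<bar>x i - x j\<bar> \<le> 2 * \<epsilon>")
  case True
  then obtain i j where ij: "i \<in> {1..n}" "j \<in> {1..n}" "i \<noteq> j" "\<bar>x i - x j\<bar> \<le> 2 * \<epsilon>" by auto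
  let ?d = "x i - x j" and ?K = "2 / deriv F 0"
  have K: "0 < ?K" using c by simp
  \<comment> \<open>The interval is taken on the side of 0 where \<open>?d\<close> lies; on the
    other side the required shift could exceed \<open>2 * \<epsilon>\<close>.\<close>
  define l where "l = (if 0 \<le> ?d then 0 else - ?K)"
  have "l \<le> 0" "0 \<le> l + ?K" using K by (auto simp: l_def)
  then obtain \<zeta> where \<zeta>: "l \<le> \<zeta>" "\<zeta> \<le> l + ?K" "(deriv F 0)\<^sup>2 / 4 \<le> \<bar>deriv (deriv F) \<zeta>\<bar>"
    using curvature[OF c] by blast
  have \<zeta>_d: "\<bar>\<zeta> - ?d\<bar> \<le> 2 * \<epsilon>"
    using \<zeta>(1,2) ij(4) \<epsilon> K unfolding l_def by (auto split: if_splits)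
  define y where "y = x(i := x i + (\<zeta> - ?d) / 2, j := x j - (\<zeta> - ?d) / 2)"
  have "\<bar>deriv (deriv F) (y i - y j)\<bar> \<le> b2"
  proof (rule derivative_boundsD(3)[OF bounds n])
    show "y 0 = 0" using ij x by (simp add: y_def)
    have "0 \<le> \<epsilon>" using K \<epsilon> by linarith
    then show "\<bar>x k - y k\<bar> \<le> \<epsilon>" for k
      using \<zeta>_d by (simp add: y_def)
  qed (use ij in auto)
  moreover have "y i - y j = \<zeta>" using ij by (simp add: y_def field_simps)
  ultimately show ?thesis using \<zeta>(3) by simp
next
  case False
  have \<epsilon>0: "0 < \<epsilon>" using c \<epsilon> by (smt (verit) divide_pos_pos)
  have "2 * \<epsilon> * b0 \<le> F (x i + \<epsilon>) - F (x i - \<epsilon>)" if i: "i \<in> {1..n}" for i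
  proof -
    obtain \<xi> where \<xi>: "x i - \<epsilon> < \<xi>" "\<xi> < x i + \<epsilon>"
      "F (x i + \<epsilon>) - F (x i - \<epsilon>) = ((x i + \<epsilon>) - (x i - \<epsilon>)) * deriv F \<xi>"
      using F_MVT[of "x i - \<epsilon>" "x i + \<epsilon>"] \<epsilon>0 by auto
    \<comment> \<open>Pairing \<open>i\<close> with vertex 0 turns a bound on differences into a
      bound at the point \<open>\<xi>\<close> itself.\<close>
    have "b0 \<le> \<bar>deriv F ((x(i := \<xi>)) i - (x(i := \<xi>)) 0)\<bar>"
    proof (rule derivative_boundsD(1)[OF bounds n])
      show "(x(i := \<xi>)) 0 = 0" using i x by simp
      show "\<bar>x k - (x(i := \<xi>)) k\<bar> \<le> \<epsilon>" for k using \<xi>(1,2) \<epsilon>0 by auto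
    qed (use i in auto)
    then have "b0 \<le> deriv F \<xi>" using i x F'_nonneg[of \<xi>] by simp
    then have "2 * \<epsilon> * b0 \<le> 2 * \<epsilon> * deriv F \<xi>" using \<epsilon>0 by simp
    then show ?thesis using \<xi>(3) by simp
  qed
  then have "(\<Sum>i\<in>{1..n}. 2 * \<epsilon> * b0) \<le> (\<Sum>i\<in>{1..n}. F (x i + \<epsilon>) - F (x i - \<epsilon>))"
    by (rule sum_mono)
  also have "\<dots> \<le> 1"
  proof (rule sum_disjoint_increments[OF _ \<epsilon>0])
    fix i j assume "i \<in> {1..n}" "j \<in> {1..n}" "i \<noteq> j"
    then show "2 * \<epsilon> < \<bar>x i - x j\<bar>" using False not_le by blast
  qed simp
  finally show ?thesis by (simp add: mult_ac)
qed

text \<open>The pair \<open>(0, 0)\<close> always has difference 0. Hence \<open>deriv F 0\<close>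
  is a scale independent of \<open>n\<close> that separates \<open>b0\<close> from
  \<open>b1\<close>.\<close>

lemma slope_at_0:
  assumes bounds: "derivative_bounds n F x \<epsilon> b0 b1 b2" and n: "1 \<le> n" and x: "x 0 = 0" and \<epsilon>: "0 < \<epsilon>"
  shows "0 < b0" "b0 \<le> deriv F 0" "deriv F 0 \<le> b1"
  using derivative_boundsD(1,2)[OF bounds n, of x 0 0] F'_nonneg[of 0] x \<epsilon> bounds
  by (auto simp: derivative_bounds_def)

text \<open>
  If \<open>\<epsilon>\<close> stays bounded, the rate is \<open>o(\<epsilon>)\<close> and hence vanishes. If \<open>\<epsilon>\<close> is large, the merits are not
  pairwise \<open>2\<epsilon>\<close>-separated, since then \<open>b0\<close> would be too small for the rate to be \<open>o(\<epsilon>)\<close>; so the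
  differences cover an interval at 0 on which the curvature of \<open>F\<close> bounds \<open>b2\<close> below, and the condition
  on \<open>b1\<^sup>4 b2 / (b0\<^sup>6 p\<^sup>4)\<close> applies.
\<close>

lemma consistency_rate_le:
  assumes bounds: "derivative_bounds n F x \<epsilon> b0 b1 b2" and n: "3 \<le> n" and x: "x 0 = 0" and \<epsilon>: "0 < \<epsilon>"
    and p: "0 < p" "p \<le> 1" and \<delta>: "0 < \<delta>"
    and r_\<epsilon>: "consistency_rate n p b0 b1 \<le> min (1 / 2) (\<delta> * deriv F 0 / 2) * \<epsilon>"
    and rate: "b1 ^ 4 * b2 / (b0 ^ 6 * p ^ 4) \<le> (deriv F 0 * \<delta> / 2)\<^sup>2 * sqrt (real n / ln (real n))"
  shows "consistency_rate n p b0 b1 \<le> \<delta>"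
proof -
  let ?c = "deriv F 0" and ?r = "consistency_rate n p b0 b1" and ?q = "ln (real n) / real n"
  note s = slope_at_0[OF bounds order.trans[OF _ n] x \<epsilon>, simplified]
  have c: "0 < ?c" using s by simp
  have ln1: "1 \<le> ln (real n)"
    using n exp_le by (subst ln_ge_iff) auto
  have q: "0 < ?q" "?q \<le> 1" using ln1 n ln_le_minus_one[of "real n"] by (auto simp: divide_le_eq)
  show ?thesis
  proof (cases "2 / ?c \<le> \<epsilon>")
    case False
    have "?r \<le> (\<delta> * ?c / 2) * \<epsilon>"
      using r_\<epsilon> \<epsilon> by (rule_tac order.trans[OF _ mult_right_mono]) auto
    also have "\<dots> \<le> (\<delta> * ?c / 2) * (2 / ?c)"
      using False \<delta> c by (intro mult_left_mono) auto
    finally show ?thesis using c by simp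
  next
    case True
    then consider "?c\<^sup>2 / 4 \<le> b2" | "2 * real n * \<epsilon> * b0 \<le> 1"
      using wide_box[OF bounds _ x c True] n by auto
    then show ?thesis
    proof cases
      case 1
      \<comment> \<open>Up to the factor \<open>?q\<close>, the product
        \<open>b2 * ?r\<^sup>2\<close> is the quantity in \<open>rate\<close>. The root in
        \<open>rate\<close> cancels half of \<open>?q\<close>, and the constant there was chosen to
        leave \<open>?c\<^sup>2 / 4 * \<delta>\<^sup>2\<close>.\<close>
      have "?c\<^sup>2 / 4 * ?r\<^sup>2 \<le> b2 * ?r\<^sup>2" using 1 by (intro mult_right_mono) auto
      also have "\<dots> = b1 ^ 4 * b2 / (b0 ^ 6 * p ^ 4) * ?q"
        using q s p by (simp add: consistency_rate_def power_mult_distrib power_divide mult_ac flip: power_mult)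
      also have "\<dots> \<le> (?c * \<delta> / 2)\<^sup>2 * sqrt (real n / ln (real n)) * ?q"
        using rate q by (intro mult_right_mono) auto
      also have "\<dots> = (?c * \<delta> / 2)\<^sup>2 * (?q / sqrt ?q)"
        by (simp add: real_sqrt_divide mult_ac)
      also have "\<dots> = (?c * \<delta> / 2)\<^sup>2 * sqrt ?q"
        using q by (simp only: real_div_sqrt less_imp_le)
      also have "\<dots> \<le> (?c * \<delta> / 2)\<^sup>2 * 1"
        using q by (intro mult_left_mono) auto
      finally have "?c\<^sup>2 / 4 * ?r\<^sup>2 \<le> ?c\<^sup>2 / 4 * \<delta>\<^sup>2" by (simp add: power_divide power_mult_distrib)
      then have "?r\<^sup>2 \<le> \<delta>\<^sup>2" using c by simp
      then show ?thesis using \<delta> by (simp add: power2_le_iff_abs_le)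
    next
      case 2
      \<comment> \<open>This case is contradictory: \<open>?r\<close> would be at most
        \<open>1 / (4 n b0)\<close>, but it is at least \<open>b1^2 / (b0^3 n)\<close>, which would
        give \<open>4 b1^2 \<le> b0^2\<close> against \<open>b0 \<le> b1\<close>.\<close>
      have "?r \<le> 1 / 2 * \<epsilon>"
        using r_\<epsilon> \<epsilon> by (rule_tac order.trans[OF _ mult_right_mono]) auto
      also have "\<epsilon> \<le> 1 / (2 * real n * b0)"
        using 2 s n by (simp add: field_simps)
      finally have up: "?r \<le> 1 / (4 * real n * b0)" by simp
      have "1 / real n \<le> sqrt ?q"
      proof (rule real_le_rsqrt)
        have "(1 / real n)\<^sup>2 = 1 / real n * (1 / real n)" by (simp add: power2_eq_square)
        also have "\<dots> \<le> ln (real n) * (1 / real n)"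
        proof (rule mult_right_mono)
          have "1 / real n \<le> 1" using n by simp
          then show "1 / real n \<le> ln (real n)" using ln1 by linarith
        qed simp
        finally show "(1 / real n)\<^sup>2 \<le> ?q" by simp
      qed
      then have "b1\<^sup>2 / b0 ^ 3 * (1 / real n) \<le> b1\<^sup>2 / b0 ^ 3 * sqrt ?q"
        using s by (intro mult_left_mono) auto
      also have "\<dots> \<le> ?r"
        unfolding consistency_rate_def using s p q
        by (intro mult_right_mono divide_left_mono) (auto simp: mult_le_cancel_left1 power_le_one)
      also note up
      finally have "b1\<^sup>2 * 4 \<le> b0\<^sup>2"
        using s n by (simp add: field_simps power2_eq_square power3_eq_cube)
      moreover have "b0\<^sup>2 \<le> b1\<^sup>2" using s by (intro power_mono) auto
      moreover have "0 < b1\<^sup>2" using s by auto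
      ultimately show ?thesis by linarith
    qed
  qed
qed

text \<open>Since \<open>b0 \<le> F'(0) \<le> b1\<close>, the factor \<open>b1^2 / b0^3\<close> is
  at least \<open>1 / F'(0)\<close>, so a small rate bounds
  \<open>sqrt (log n / n) / p^2\<close>.\<close>

lemma edge_density:
  assumes bounds: "derivative_bounds n F x \<epsilon> b0 b1 b2" and n: "3 \<le> n" and x: "x 0 = 0" and \<epsilon>: "0 < \<epsilon>"
    and p: "0 < p" and r: "consistency_rate n p b0 b1 \<le> 1 / (4 * deriv F 0)"
  shows "16 * ln (real n) \<le> real n * p ^ 4"
proof -
  let ?c = "deriv F 0" and ?q = "ln (real n) / real n"
  note s = slope_at_0[OF bounds order.trans[OF _ n] x \<epsilon>, simplified]
  have c: "0 < ?c" using s by simp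
  have q: "0 \<le> ?q" using n by simp
  have "1 / ?c = ?c\<^sup>2 / ?c ^ 3" using c by (simp add: power2_eq_square power3_eq_cube)
  also have "\<dots> \<le> b1\<^sup>2 / b0 ^ 3" using s c by (intro frac_le power_mono) auto
  finally have "1 / ?c * (1 / p\<^sup>2 * sqrt ?q) \<le> b1\<^sup>2 / b0 ^ 3 * (1 / p\<^sup>2 * sqrt ?q)"
    using q by (intro mult_right_mono) auto
  also have "\<dots> = consistency_rate n p b0 b1" by (simp add: consistency_rate_def)
  also note r
  finally have "4 * sqrt ?q \<le> p\<^sup>2" using c p by (simp add: field_simps)
  then have "(4 * sqrt ?q)\<^sup>2 \<le> (p\<^sup>2)\<^sup>2" using q by (intro power_mono) auto
  then have "16 * ?q \<le> p ^ 4" using q by (simp add: power_mult_distrib flip: power_mult)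
  then show ?thesis using n by (simp add: field_simps)
qed

subsection \<open>Consistency on a good event\<close>

text \<open>The non-asymptotic core. The error bound covers every solution at a good sample point,
  so it applies to whichever one an estimator picks.\<close>

lemma paired_comparison_good_event:
  fixes M :: "'a measure"
  assumes model: "paired_comparison M n T p F x t a"
    and F_sym: "\<And>x. F x = 1 - F (- x)" and T: "1 \<le> T"
    and bounds: "derivative_bounds n F x \<epsilon> b0 b1 b2" and n: "3 \<le> n" and \<epsilon>: "0 < \<epsilon>"
    and r_\<epsilon>: "17 * real T * consistency_rate n p b0 b1 \<le> \<epsilon>"
    and dense: "16 * ln (real n) \<le> real n * p ^ 4"
  obtains G where "G \<in> sets M"
    "1 - (2 * (real n + 1) / real n ^ 2 + (real n + 1)\<^sup>2 / real n ^ 3) \<le> measure M G"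
    "\<And>\<omega>. \<omega> \<in> G \<Longrightarrow> \<exists>\<beta>. moment_solution n F (\<lambda>i j. t i j \<omega>) (\<lambda>i j. a i j \<omega>) \<beta>"
    "\<And>\<omega> \<beta>. \<lbrakk>\<omega> \<in> G; moment_solution n F (\<lambda>i j. t i j \<omega>) (\<lambda>i j. a i j \<omega>) \<beta>\<rbrakk>
      \<Longrightarrow> \<bar>sup_dist n \<beta> x\<bar> \<le> 17 * real T * consistency_rate n p b0 b1"
proof -
  interpret M: paired_comparison M n T p F x t a by fact
  have n1: "1 \<le> n" using n by simp
  have x0: "x 0 = 0" by (rule M.\<beta>s_0)
  note b = slope_at_0[OF bounds n1 x0 \<epsilon>]
  have ln0: "0 < ln (real n)" using n by simp
  \<comment> \<open>The factor 2 turns the Hoeffding exponent into \<open>2 log n\<close>, so a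
    union over \<open>n + 1\<close> vertices costs order \<open>1 / n\<close>.\<close>
  define E where "E = 2 * real T * sqrt (real n * ln (real n))"
  define m where "m = (real n - 1) * p\<^sup>2 / 2"
  \<comment> \<open>As \<open>m\<close> is at least \<open>n p^2 / 4\<close>, the constant 17 makes
    \<open>b0 * m * R\<close> at least \<open>17/4\<close> times \<open>T sqrt (n log n)\<close>,
    just above the factor 4 in \<open>2 * E\<close>.\<close>
  define R where "R = 17 * real T / (b0 * p\<^sup>2) * sqrt (ln (real n) / real n)"
  have E0: "0 \<le> E" using ln0 by (simp add: E_def)
  have m0: "0 < m" using n M.p_pos by (simp add: m_def)
  have R0: "0 < R" using T b(1) M.p_pos ln0 n by (simp add: R_def)
  have R_le: "R \<le> 17 * real T * consistency_rate n p b0 b1"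
  proof -
    have "1 / b0 = b0\<^sup>2 / b0 ^ 3" using b(1) by (simp add: power2_eq_square power3_eq_cube)
    also have "\<dots> \<le> b1\<^sup>2 / b0 ^ 3" using b by (intro divide_right_mono power_mono) auto
    finally have "1 / b0 * (17 * real T / p\<^sup>2 * sqrt (ln (real n) / real n)) \<le>
        b1\<^sup>2 / b0 ^ 3 * (17 * real T / p\<^sup>2 * sqrt (ln (real n) / real n))"
      using ln0 by (intro mult_right_mono) auto
    then show ?thesis by (simp add: R_def consistency_rate_def mult_ac)
  qed
  have small: "2 * E < b0 * m * R"
  proof -
    have sq: "real n * sqrt (ln (real n) / real n) = sqrt (real n * ln (real n))"
      using n by (simp add: real_sqrt_divide real_sqrt_mult field_simps)
    have "2 * E < 17 / 4 * real T * sqrt (real n * ln (real n))"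
      using T n ln0 by (simp add: E_def)
    also have "\<dots> = 17 / 4 * real T * (real n * sqrt (ln (real n) / real n))" by (simp only: sq)
    also have "\<dots> = b0 * (real n * p\<^sup>2 / 4) * R"
      using b(1) M.p_pos by (simp add: R_def field_simps)
    also have "\<dots> \<le> b0 * m * R"
    proof (intro mult_right_mono mult_left_mono)
      have "real n * p\<^sup>2 \<le> (2 * (real n - 1)) * p\<^sup>2" using n by (intro mult_right_mono) auto
      then show "real n * p\<^sup>2 / 4 \<le> m" by (simp add: m_def algebra_simps)
    qed (use R0 b(1) in auto)
    finally show ?thesis .
  qed
  define noisy where "noisy i = {\<omega> \<in> space M. E \<le> \<bar>\<Sum>j=0..n. real (a i j \<omega>) - real (t i j \<omega>) * F (x i - x j)\<bar>}" for i
  define sparse where "sparse q = {\<omega> \<in> space M. real (card {j. j \<le> n \<and> 0 < t (fst q) j \<omega> \<and> 0 < t (snd q) j \<omega>}) \<le> m}" for q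
  let ?I = "{..n}" and ?J = "{q \<in> {..n} \<times> {..n}. fst q \<noteq> snd q}"
  have finJ: "finite ?J" by (rule finite_subset[of _ "{..n} \<times> {..n}"]) auto
  have noisy_sets: "noisy i \<in> sets M" if "i \<in> ?I" for i
    unfolding noisy_def using that
    by (intro M.count_event_measurable[where P = "\<lambda>\<tau> \<alpha>. E \<le> \<bar>\<Sum>j=0..n. real (\<alpha> i j) - real (\<tau> i j) * F (x i - x j)\<bar>"])
       (auto intro!: arg_cong[where f = "\<lambda>x. E \<le> \<bar>x\<bar>"] sum.cong)
  have sparse_sets: "sparse q \<in> sets M" if "q \<in> ?J" for q
    unfolding sparse_def using that
    by (intro M.count_event_measurable[where P = "\<lambda>\<tau> \<alpha>. real (card {j. j \<le> n \<and> 0 < \<tau> (fst q) j \<and> 0 < \<tau> (snd q) j}) \<le> m"])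
       (auto intro!: arg_cong[where f = "\<lambda>S. real (card S) \<le> m"])
  have noisy_prob: "measure M (noisy i) \<le> 2 / real n ^ 2" if "i \<in> ?I" for i
  proof -
    have "measure M (noisy i) \<le> 2 * exp (- E\<^sup>2 / (2 * real n * (real T)\<^sup>2))"
      unfolding noisy_def using that by (intro M.noise_bound F_01 F_sym n1 T E0) auto
    also have "- E\<^sup>2 / (2 * real n * (real T)\<^sup>2) = - (2 * ln (real n))"
      using n T ln0 by (simp add: E_def field_simps)
    also have "exp (- (2 * ln (real n))) = 1 / real n ^ 2"
      using n by (simp add: exp_minus exp_of_nat_mult[of 2, simplified] inverse_eq_divide power_divide)
    finally show ?thesis by simp
  qed
  have sparse_prob: "measure M (sparse q) \<le> 1 / real n ^ 3" if "q \<in> ?J" for q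
  proof -
    have "measure M (sparse q) \<le> exp (- (real n - 1) * p ^ 4 / 2)"
      unfolding sparse_def m_def using that n T by (intro M.few_common_neighbours) auto
    \<comment> \<open>\<open>dense\<close> gives exponent at least \<open>4 log n\<close>; using 3
      of it beats the roughly \<open>n^2\<close> pairs.\<close>
    also have "\<dots> \<le> exp (- (3 * ln (real n)))"
    proof -
      have "real n * p ^ 4 \<le> 2 * ((real n - 1) * p ^ 4)"
        using n mult_right_mono[of "real n" "2 * (real n - 1)" "p ^ 4"] by (simp add: algebra_simps)
      moreover have "- (real n - 1) * p ^ 4 / 2 = - (((real n - 1) * p ^ 4) / 2)"
        by (simp only: mult_minus_left minus_divide_left)
      ultimately show ?thesis using dense ln0 unfolding exp_le_cancel_iff by linarith
    qed
    also have "exp (- (3 * ln (real n))) = 1 / real n ^ 3"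
      using n by (simp add: exp_minus exp_of_nat_mult[of 3, simplified] inverse_eq_divide power_divide)
    finally show ?thesis .
  qed
  define B where "B = (\<Union>i\<in>?I. noisy i) \<union> (\<Union>q\<in>?J. sparse q)"
  have B_sets: "B \<in> sets M"
    unfolding B_def using noisy_sets sparse_sets finJ by (intro sets.Un sets.finite_UN) auto
  have "measure M B \<le> measure M (\<Union>i\<in>?I. noisy i) + measure M (\<Union>q\<in>?J. sparse q)"
    unfolding B_def using noisy_sets sparse_sets finJ
    by (intro measure_Un_le sets.finite_UN) auto
  also have "\<dots> \<le> (\<Sum>i\<in>?I. measure M (noisy i)) + (\<Sum>q\<in>?J. measure M (sparse q))"
    using noisy_sets sparse_sets finJ by (intro add_mono M.finite_measure_subadditive_finite) auto
  also have "\<dots> \<le> (\<Sum>i\<in>?I. 2 / real n ^ 2) + (\<Sum>q\<in>?J. 1 / real n ^ 3)"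
    using noisy_prob sparse_prob by (intro add_mono sum_mono) auto
  also have "\<dots> \<le> (\<Sum>i\<in>?I. 2 / real n ^ 2) + (\<Sum>q\<in>{..n} \<times> {..n}. 1 / real n ^ 3)"
    by (intro add_left_mono sum_mono2) auto
  also have "\<dots> = 2 * (real n + 1) / real n ^ 2 + (real n + 1)\<^sup>2 / real n ^ 3"
    by (simp add: power2_eq_square add_divide_distrib distrib_left distrib_right)
  finally have B_prob: "measure M B \<le> 2 * (real n + 1) / real n ^ 2 + (real n + 1)\<^sup>2 / real n ^ 3" .
  have good: "(\<exists>\<beta>. moment_solution n F (\<lambda>i j. t i j \<omega>) (\<lambda>i j. a i j \<omega>) \<beta>) \<and>
      (\<forall>\<beta>. moment_solution n F (\<lambda>i j. t i j \<omega>) (\<lambda>i j. a i j \<omega>) \<beta> \<longrightarrow> \<bar>sup_dist n \<beta> x\<bar> \<le> R)"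
    if \<omega>: "\<omega> \<in> space M - B" for \<omega>
  proof -
    let ?t = "\<lambda>i j. t i j \<omega>" and ?a = "\<lambda>i j. a i j \<omega>"
    have \<omega>M: "\<omega> \<in> space M" using \<omega> by simp
    have "continuous_on UNIV F"
      using F_deriv by (intro DERIV_continuous_on) (auto intro: has_field_derivative_at_within)
    then interpret C: comparison_equations n F ?t ?a
      using \<omega>M
      by (intro comparison_equations.intro F_mono F_sym) (auto intro: M.t_sym M.t_diag M.a_total_all)
    have noise: "\<bar>C.wins i - C.score x i\<bar> \<le> E" if "i \<le> n" for i
    proof -
      have "\<omega> \<notin> noisy i" using \<omega> that by (auto simp: B_def)
      then show ?thesis
        using \<omega>M by (simp add: noisy_def C.wins_def C.score_def sum_subtractf)
    qed
    have common: "m \<le> real (card (C.common_neighbours i k))" if "i \<le> n" "k \<le> n" "i \<noteq> k" for i k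
    proof -
      have "\<omega> \<notin> sparse (i, k)" using \<omega> that by (auto simp: B_def)
      then show ?thesis
        using \<omega>M by (simp add: sparse_def C.common_neighbours_def)
    qed
    have in_ball: "b0 \<le> deriv F (y i - y j)"
      if "y 0 = 0" "\<And>i. i \<le> n \<Longrightarrow> \<bar>y i - x i\<bar> \<le> R" "i \<le> n" "j \<le> n" for y i j
    proof -
      have "\<bar>x l - y l\<bar> \<le> \<epsilon>" if "l \<in> {1..n}" for l
        using \<open>\<And>i. i \<le> n \<Longrightarrow> \<bar>y i - x i\<bar> \<le> R\<close>[of l] R_le r_\<epsilon> that by (simp add: abs_minus_commute)
      then have "b0 \<le> \<bar>deriv F (y i - y j)\<bar>"
        using that by (intro derivative_boundsD(1)[OF bounds n1]) auto
      then show ?thesis using F'_nonneg by simp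
    qed
    obtain y where y: "moment_solution n F ?t ?a y" "\<And>i. i \<le> n \<Longrightarrow> \<bar>y i - x i\<bar> \<le> R"
    proof (rule C.moment_solution_exists[OF x0 R0 b(1) noise _ common small])
      fix y i j
      assume y: "y 0 = 0" "\<And>i. i \<le> n \<Longrightarrow> \<bar>y i - x i\<bar> \<le> R" "i \<le> n" "j \<le> n" "x i - x j \<le> y i - y j"
      let ?dx = "x i - x j" and ?dy = "y i - y j"
      show "b0 * (?dy - ?dx) \<le> F ?dy - F ?dx"
      proof (cases "?dx = ?dy")
        case False
        then have less: "?dx < ?dy" using y(5) by simp
        obtain \<xi> where \<xi>: "?dx < \<xi>" "\<xi> < ?dy" "F ?dy - F ?dx = (?dy - ?dx) * deriv F \<xi>"
          using F_MVT[OF less] by auto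
        \<comment> \<open>The derivative bounds speak only of differences within one parameter
          vector. The mean value point is such a difference for a point \<open>z\<close> on the
          segment from \<open>x\<close> to \<open>y\<close>, which stays in the convex box.\<close>
        define \<theta> where "\<theta> = (\<xi> - ?dx) / (?dy - ?dx)"
        have \<theta>: "0 \<le> \<theta>" "\<theta> \<le> 1" using \<xi> by (auto simp: \<theta>_def divide_le_eq)
        define z where "z l = x l + \<theta> * (y l - x l)" for l
        have "b0 \<le> deriv F (z i - z j)"
        proof (rule in_ball)
          show "z 0 = 0" using x0 y(1) by (simp add: z_def)
          fix l assume "l \<le> n"
          have "\<bar>z l - x l\<bar> = \<theta> * \<bar>y l - x l\<bar>" using \<theta> by (simp add: z_def abs_mult)
          also have "\<dots> \<le> 1 * \<bar>y l - x l\<bar>" using \<theta> by (intro mult_right_mono) auto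
          finally show "\<bar>z l - x l\<bar> \<le> R" using y(2)[OF \<open>l \<le> n\<close>] by simp
        qed fact+
        also have "z i - z j = ?dx + \<theta> * (?dy - ?dx)" by (simp add: z_def algebra_simps)
        also have "\<dots> = \<xi>" using less by (simp add: \<theta>_def)
        finally have "b0 \<le> deriv F \<xi>" .
        then have "b0 * (?dy - ?dx) \<le> deriv F \<xi> * (?dy - ?dx)"
          using less by (intro mult_right_mono) auto
        then show ?thesis using \<xi>(3) by (simp add: mult.commute)
      qed simp
    qed auto
    have y0: "y 0 = 0" using y(1) by (simp add: moment_solution_def)
    have unique: "\<beta> i = y i" if "moment_solution n F ?t ?a \<beta>" "i \<le> n" for \<beta> i
    proof (rule C.moment_solution_unique[OF y(1) that(1) _ _ that(2)])
      fix i j assume "i \<le> n" "j \<le> n"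
      then have "0 < deriv F (y i - y j)"
        using in_ball[OF y0 y(2)] b(1) by (meson less_le_trans)
      then show "\<exists>d>0. (F has_real_derivative d) (at (y i - y j))" using F_deriv by blast
    next
      fix i k assume "i \<le> n" "k \<le> n" "i \<noteq> k"
      then show "C.common_neighbours i k \<noteq> {}" using common[of i k] m0 by auto
    qed
    show ?thesis
    proof (intro conjI allI impI)
      show "\<exists>\<beta>. moment_solution n F ?t ?a \<beta>" using y(1) by blast
      fix \<beta> assume "moment_solution n F ?t ?a \<beta>"
      then have "\<beta> i = y i" if "i \<le> n" for i using unique that by blast
      then show "\<bar>sup_dist n \<beta> x\<bar> \<le> R" using y(2) by (intro sup_dist_leI n1) simp
    qed
  qed
  show thesis
  proof (rule that[of "space M - B"])
    show "space M - B \<in> sets M" using B_sets by auto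
    show "1 - (2 * (real n + 1) / real n ^ 2 + (real n + 1)\<^sup>2 / real n ^ 3) \<le> measure M (space M - B)"
      using B_prob by (simp add: M.prob_compl[OF B_sets])
    show "\<exists>\<beta>. moment_solution n F (\<lambda>i j. t i j \<omega>) (\<lambda>i j. a i j \<omega>) \<beta>" if "\<omega> \<in> space M - B" for \<omega>
      using good[OF that] by blast
    show "\<bar>sup_dist n \<beta> x\<bar> \<le> 17 * real T * consistency_rate n p b0 b1"
      if "\<omega> \<in> space M - B" "moment_solution n F (\<lambda>i j. t i j \<omega>) (\<lambda>i j. a i j \<omega>) \<beta>" for \<omega> \<beta>
      using good[OF that(1)] that(2) R_le by (meson order.trans)
  qed
qed

end

section \<open>Passage to the limit\<close>

theorem theorem1:
  fixes D :: "real measure" and F :: "real \<Rightarrow> real" and T :: nat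
    and M :: "nat \<Rightarrow> 'a measure"
    and t a :: "nat \<Rightarrow> nat \<Rightarrow> nat \<Rightarrow> 'a \<Rightarrow> nat"
    and \<beta>s :: "nat \<Rightarrow> nat \<Rightarrow> real"
    and p \<epsilon> b0 b1 b2 :: "nat \<Rightarrow> real"
  assumes F_cdf: "real_distribution D" "F = cdf D"
    and F_symmetric: "\<And>x. F x = 1 - F (- x)"
    and F_continuous: "continuous_on UNIV F"
    and F_third_derivative: "\<And>k x. k < 3 \<Longrightarrow> (deriv ^^ k) F differentiable (at x)"
    and T: "T \<ge> 1"
    and model: "\<And>n. n \<ge> 1 \<Longrightarrow> paired_comparison (M n) n T (p n) F (\<beta>s n) (t n) (a n)"
    and \<epsilon>_pos: "\<And>n. n \<ge> 1 \<Longrightarrow> \<epsilon> n > 0"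
    and bounds: "\<And>n. n \<ge> 1 \<Longrightarrow> derivative_bounds n F (\<beta>s n) (\<epsilon> n) (b0 n) (b1 n) (b2 n)"
    and rate: "(\<lambda>n. (b1 n) ^ 4 * b2 n / ((b0 n) ^ 6 * (p n) ^ 4)) \<in> o(\<lambda>n. sqrt (real n / ln (real n)))"
    and \<epsilon>_dominates: "(\<lambda>n. consistency_rate n (p n) (b0 n) (b1 n)) \<in> o(\<epsilon>)"
  shows "(\<lambda>n. measure (M n) {\<omega> \<in> space (M n).
            \<exists>\<beta>. moment_solution n F (\<lambda>i j. t n i j \<omega>) (\<lambda>i j. a n i j \<omega>) \<beta>}) \<longlonglongrightarrow> 1
    \<and> (\<forall>\<beta>h. (\<forall>n\<ge>1. moment_estimator (M n) n F (t n) (a n) (\<beta>h n)) \<longrightarrow>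
          big_O_p M (\<lambda>n \<omega>. sup_dist n (\<beta>h n \<omega>) (\<beta>s n))
            (\<lambda>n. consistency_rate n (p n) (b0 n) (b1 n))
        \<and> small_o_p M (\<lambda>n \<omega>. sup_dist n (\<beta>h n \<omega>) (\<beta>s n)) (\<lambda>_. 1))"
proof -
  interpret D: real_distribution D by fact
  interpret smooth_cdf D F
    by unfold_locales (use F_cdf(2) F_third_derivative[of 0] F_third_derivative[of 1] in auto)
  define r where "r n = consistency_rate n (p n) (b0 n) (b1 n)" for n
  define \<delta> where "\<delta> n = 2 * (real n + 1) / real n ^ 2 + (real n + 1)\<^sup>2 / real n ^ 3" for n :: nat
  define S where "S n = {\<omega> \<in> space (M n). \<exists>\<beta>. moment_solution n F (\<lambda>i j. t n i j \<omega>) (\<lambda>i j. a n i j \<omega>) \<beta>}" for n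
  have \<delta>_lim: "\<delta> \<longlonglongrightarrow> 0" unfolding \<delta>_def by real_asymp
  have \<beta>s_0: "\<beta>s n 0 = 0" and p: "0 < p n" "p n \<le> 1" and ps: "prob_space (M n)" if "1 \<le> n" for n
  proof -
    interpret paired_comparison "M n" n T "p n" F "\<beta>s n" "t n" "a n" by (rule model[OF that])
    show "\<beta>s n 0 = 0" "0 < p n" "p n \<le> 1" "prob_space (M n)"
      using \<beta>s_0 p_pos p_le_1 prob_space_axioms by auto
  qed
  have c: "0 < deriv F 0"
    using slope_at_0[OF bounds _ \<beta>s_0 \<epsilon>_pos, of 1] by simp
  have r_nonneg: "0 \<le> r n" if "3 \<le> n" for n
    using slope_at_0(1)[OF bounds _ \<beta>s_0 \<epsilon>_pos, of n] that by (simp add: r_def consistency_rate_def)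
  have r_small: "eventually (\<lambda>n. r n \<le> d) sequentially" if d: "0 < d" for d
  proof -
    have "eventually (\<lambda>n. norm (consistency_rate n (p n) (b0 n) (b1 n)) \<le> min (1 / 2) (d * deriv F 0 / 2) * norm (\<epsilon> n)) sequentially"
      using d c by (intro landau_o.smallD[OF \<epsilon>_dominates]) simp
    moreover have "eventually (\<lambda>n. norm ((b1 n) ^ 4 * b2 n / ((b0 n) ^ 6 * (p n) ^ 4)) \<le>
        (deriv F 0 * d / 2)\<^sup>2 * norm (sqrt (real n / ln (real n)))) sequentially"
      using d c by (intro landau_o.smallD[OF rate]) simp
    moreover have "eventually (\<lambda>n::nat. 3 \<le> n) sequentially" by (rule eventually_ge_at_top)
    ultimately show ?thesis
    proof eventually_elim
      case (elim n)
      then have n1: "1 \<le> n" by simp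
      show ?case
        unfolding r_def
      proof (rule consistency_rate_le[OF bounds[OF n1] elim(3) \<beta>s_0[OF n1] \<epsilon>_pos[OF n1] p[OF n1] d])
        show "consistency_rate n (p n) (b0 n) (b1 n) \<le> min (1 / 2) (d * deriv F 0 / 2) * \<epsilon> n"
          using elim(1) \<epsilon>_pos[OF n1] by simp
        have "0 \<le> sqrt (real n / ln (real n))" using n1 by simp
        then show "b1 n ^ 4 * b2 n / (b0 n ^ 6 * p n ^ 4) \<le> (deriv F 0 * d / 2)\<^sup>2 * sqrt (real n / ln (real n))"
          using elim(2) by (simp only: real_norm_def abs_of_nonneg abs_le_iff)
      qed
    qed
  qed
  define good where "good n G \<longleftrightarrow> G \<in> sets (M n) \<and> 1 - \<delta> n \<le> measure (M n) G \<and> G \<subseteq> S n \<and>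
      (\<forall>\<omega>\<in>G. \<forall>\<beta>. moment_solution n F (\<lambda>i j. t n i j \<omega>) (\<lambda>i j. a n i j \<omega>) \<beta> \<longrightarrow>
        \<bar>sup_dist n \<beta> (\<beta>s n)\<bar> \<le> 17 * real T * r n)" for n G
  \<comment> \<open>\<open>\<epsilon>_dominates\<close> serves here to place the box of the error
    bound inside the ball where the derivative bounds hold.\<close>
  have "eventually (\<lambda>n. norm (consistency_rate n (p n) (b0 n) (b1 n)) \<le> 1 / (17 * real T) * norm (\<epsilon> n)) sequentially"
    using T by (intro landau_o.smallD[OF \<epsilon>_dominates]) simp
  moreover have "eventually (\<lambda>n. r n \<le> 1 / (4 * deriv F 0)) sequentially"
    using c by (intro r_small) simp
  moreover have "eventually (\<lambda>n::nat. 3 \<le> n) sequentially" by (rule eventually_ge_at_top)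
  ultimately have good_ev: "eventually (\<lambda>n. 3 \<le> n \<and> (\<exists>G. good n G)) sequentially"
  proof eventually_elim
    case (elim n)
    then have n1: "1 \<le> n" by simp
    have r_\<epsilon>: "17 * real T * consistency_rate n (p n) (b0 n) (b1 n) \<le> \<epsilon> n"
      using elim(1) \<epsilon>_pos[OF n1] T r_nonneg[OF elim(3)] by (simp add: r_def field_simps)
    have dense: "16 * ln (real n) \<le> real n * p n ^ 4"
      using elim(2) unfolding r_def
      by (intro edge_density[OF bounds[OF n1] elim(3) \<beta>s_0[OF n1] \<epsilon>_pos[OF n1] p(1)[OF n1]])
    obtain G where G: "G \<in> sets (M n)" "1 - \<delta> n \<le> measure (M n) G"
      "\<And>\<omega>. \<omega> \<in> G \<Longrightarrow> \<exists>\<beta>. moment_solution n F (\<lambda>i j. t n i j \<omega>) (\<lambda>i j. a n i j \<omega>) \<beta>"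
      "\<And>\<omega> \<beta>. \<lbrakk>\<omega> \<in> G; moment_solution n F (\<lambda>i j. t n i j \<omega>) (\<lambda>i j. a n i j \<omega>) \<beta>\<rbrakk>
        \<Longrightarrow> \<bar>sup_dist n \<beta> (\<beta>s n)\<bar> \<le> 17 * real T * r n"
      using paired_comparison_good_event[OF model[OF n1] F_symmetric T bounds[OF n1] elim(3) \<epsilon>_pos[OF n1] r_\<epsilon> dense]
      unfolding \<delta>_def r_def by blast
    have "G \<subseteq> S n" unfolding S_def using G(3) sets.sets_into_space[OF G(1)] by blast
    then have "good n G" unfolding good_def using G(1,2,4) by blast
    then show ?case using elim(3) by blast
  qed
  have S_sets: "S n \<in> sets (M n)" if "1 \<le> n" for n
  proof -
    interpret paired_comparison "M n" n T "p n" F "\<beta>s n" "t n" "a n" by (rule model[OF that])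
    show ?thesis
      unfolding S_def
    proof (rule count_event_measurable[where P = "\<lambda>\<tau> \<alpha>. \<exists>\<beta>. moment_solution n F \<tau> \<alpha> \<beta>"])
      fix \<tau> \<tau>' \<alpha> \<alpha>' :: "nat \<Rightarrow> nat \<Rightarrow> nat"
      assume eq: "\<And>i j. \<lbrakk>i \<le> n; j \<le> n\<rbrakk> \<Longrightarrow> \<tau> i j = \<tau>' i j" "\<And>i j. \<lbrakk>i \<le> n; j \<le> n\<rbrakk> \<Longrightarrow> \<alpha> i j = \<alpha>' i j"
      have "moment_solution n F \<tau> \<alpha> \<beta> \<longleftrightarrow> moment_solution n F \<tau>' \<alpha>' \<beta>" for \<beta>
        unfolding moment_solution_def using eq
        by (intro conj_cong ball_cong refl arg_cong2[where f = "(=)"] arg_cong[where f = real] sum.cong) auto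
      then show "(\<exists>\<beta>. moment_solution n F \<tau> \<alpha> \<beta>) \<longleftrightarrow> (\<exists>\<beta>. moment_solution n F \<tau>' \<alpha>' \<beta>)" by simp
    qed
  qed
  have "(\<lambda>n. measure (M n) (S n)) \<longlonglongrightarrow> 1"
  proof (rule tendsto_sandwich)
    show "(\<lambda>n. 1 - \<delta> n) \<longlonglongrightarrow> 1" using tendsto_diff[OF tendsto_const \<delta>_lim, of 1] by simp
    show "(\<lambda>n. 1 :: real) \<longlonglongrightarrow> 1" by simp
    show "eventually (\<lambda>n. 1 - \<delta> n \<le> measure (M n) (S n)) sequentially"
      using good_ev
    proof eventually_elim
      case (elim n)
      then obtain G where G: "good n G" "1 \<le> n" by auto
      interpret prob_space "M n" by (rule ps[OF G(2)])
      show ?case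
        using G finite_measure_mono[OF _ S_sets[OF G(2)], of G] by (auto simp: good_def)
    qed
    show "eventually (\<lambda>n. measure (M n) (S n) \<le> 1) sequentially"
      using eventually_ge_at_top[of 1] by eventually_elim (rule prob_space.prob_le_1[OF ps])
  qed
  moreover have "big_O_p M (\<lambda>n \<omega>. sup_dist n (\<beta>h n \<omega>) (\<beta>s n)) r \<and>
      small_o_p M (\<lambda>n \<omega>. sup_dist n (\<beta>h n \<omega>) (\<beta>s n)) (\<lambda>_. 1)"
    if \<beta>h: "\<forall>n\<ge>1. moment_estimator (M n) n F (t n) (a n) (\<beta>h n)" for \<beta>h
  proof -
    \<comment> \<open>One tail bound for all thresholds \<open>u\<close> gives both claims:
      \<open>u\<close> is a multiple of the rate for boundedness, and a constant, eventually above
      that multiple, for convergence to 0. The passage through the measurable set \<open>G\<close>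
      bounds the outer event.\<close>
    have tail: "eventually (\<lambda>n. \<forall>u\<ge>17 * real T * r n.
        measure (M n) {\<omega> \<in> space (M n). u < \<bar>sup_dist n (\<beta>h n \<omega>) (\<beta>s n)\<bar>} \<le> \<delta> n) sequentially"
      using good_ev
    proof eventually_elim
      case (elim n)
      then obtain G where G: "good n G" "1 \<le> n" by auto
      interpret prob_space "M n" by (rule ps[OF G(2)])
      show ?case
      proof (intro allI impI)
        fix u assume u: "17 * real T * r n \<le> u"
        have "\<bar>sup_dist n (\<beta>h n \<omega>) (\<beta>s n)\<bar> \<le> u" if "\<omega> \<in> G" for \<omega>
        proof -
          have "\<omega> \<in> S n" using G(1) that by (auto simp: good_def)
          then have "moment_solution n F (\<lambda>i j. t n i j \<omega>) (\<lambda>i j. a n i j \<omega>) (\<beta>h n \<omega>)"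
            using \<beta>h G(2) by (auto simp: S_def moment_estimator_def)
          then show ?thesis using G(1) that u by (force simp: good_def)
        qed
        then have "{\<omega> \<in> space (M n). u < \<bar>sup_dist n (\<beta>h n \<omega>) (\<beta>s n)\<bar>} \<subseteq> space (M n) - G"
          by (auto simp: not_less[symmetric])
        moreover have "space (M n) - G \<in> sets (M n)" using G(1) by (auto simp: good_def)
        ultimately have "measure (M n) {\<omega> \<in> space (M n). u < \<bar>sup_dist n (\<beta>h n \<omega>) (\<beta>s n)\<bar>}
            \<le> measure (M n) (space (M n) - G)"
          by (rule finite_measure_mono)
        then show "measure (M n) {\<omega> \<in> space (M n). u < \<bar>sup_dist n (\<beta>h n \<omega>) (\<beta>s n)\<bar>} \<le> \<delta> n"
          using G(1) prob_compl[of G] by (simp add: good_def)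
      qed
    qed
    have "big_O_p M (\<lambda>n \<omega>. sup_dist n (\<beta>h n \<omega>) (\<beta>s n)) r"
      unfolding big_O_p_def
    \<comment> \<open>The same constant works for every \<open>\<eta>\<close>, because the failure
      probability itself tends to 0.\<close>
    proof (intro allI impI exI[of _ "17 * real T"] conjI)
      show "0 < 17 * real T" using T by simp
      fix \<eta> :: real assume "0 < \<eta>"
      then have "eventually (\<lambda>n. \<delta> n < \<eta>) sequentially"
        using order_tendstoD(2)[OF \<delta>_lim] by simp
      with tail eventually_ge_at_top[of 3]
      show "eventually (\<lambda>n. measure (M n) {\<omega> \<in> space (M n).
          17 * real T * \<bar>r n\<bar> < \<bar>sup_dist n (\<beta>h n \<omega>) (\<beta>s n)\<bar>} < \<eta>) sequentially"
      proof eventually_elim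
        case (elim n)
        have "17 * real T * r n \<le> 17 * real T * \<bar>r n\<bar>" by (intro mult_left_mono) auto
        then show ?case using elim by (meson le_less_trans)
      qed
    qed
    moreover have "small_o_p M (\<lambda>n \<omega>. sup_dist n (\<beta>h n \<omega>) (\<beta>s n)) (\<lambda>_. 1)"
      unfolding small_o_p_def
    proof (intro allI impI)
      fix d :: real assume d: "0 < d"
      show "(\<lambda>n. measure (M n) {\<omega> \<in> space (M n). d * \<bar>1\<bar> < \<bar>sup_dist n (\<beta>h n \<omega>) (\<beta>s n)\<bar>}) \<longlonglongrightarrow> 0"
      proof (rule tendsto_sandwich[OF _ _ tendsto_const \<delta>_lim])
        have "eventually (\<lambda>n. r n \<le> d / (17 * real T)) sequentially"
          using d T by (intro r_small) simp
        with tail show "eventually (\<lambda>n. measure (M n) {\<omega> \<in> space (M n).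
            d * \<bar>1\<bar> < \<bar>sup_dist n (\<beta>h n \<omega>) (\<beta>s n)\<bar>} \<le> \<delta> n) sequentially"
        proof eventually_elim
          case (elim n)
          then have "17 * real T * r n \<le> d * \<bar>1\<bar>" using T by (simp add: field_simps)
          then show ?case using elim(1) by blast
        qed
      qed simp
    qed
    ultimately show ?thesis by blast
  qed
  ultimately show ?thesis unfolding S_def r_def by blast
qed

end
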